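(* Let $G$ be a compact and metrizable topological abelian group equipped with its Borel $\sigma$-algebra, and let $\mu$ denote the Haar probability measure on $G$. For any $G$-valued random variables $X,Y$ with finite entropies there is a non-empty, closed subset $S$ of $G$ of positive Haar measure such that, if $U_S$ is uniformly distributed on $S$, then, for any constant $C\geq4$, $$d_{\mathrm R}(U_S,Y)\leq(C+2)\,d_{\mathrm R}(X,Y)+H_2(1-2/C)$$ and $$\log\frac{\mu(S-S)}{\mu(S)}\leq(2C+4)\,d_{\mathrm R}(X,Y)+2H_2(1-2/C).$$
   Context: For a $G$-valued random variable $X$, the entropy is $h(X):=-\int_G f\log f\,d\mu$ if the law of $X$ has a density $f$ with respect to $\mu$, and $h(X):=-\infty$ otherwise ($\log$ is the natural logarithm); one always has $h(X)\in[-\infty,0]$. "Finite entropy" means $h(X)>-\infty$. The Ruzsa distance between random variables $X,Y$ with finite entropies is $d_{\mathrm R}(X,Y):=h(X'-Y')-\frac12h(X)-\frac12h(Y)$, where $X',Y'$ are independent and have the same marginal laws as $X$ and $Y$, respectively (so $d_{\mathrm R}$ depends only on the marginals). For $p\in[0,1]$, $H_2(p)=-p\log p-(1-p)\log(1-p)$ is the binary entropy function. $S-S=\{s-s':s,s'\in S\}$. "Uniformly distributed on $S$" means having density $\mathbb{I}_S/\mu(S)$ with respect to $\mu$. *)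

theory Defs
  imports "HOL-Probability.Probability"
begin

text \<open>
  Haar probability measures on a group \<open>G\<close>, here the type \<open>'a\<close>. On a compact metrizable group such
  a measure is unique, and it is automatically regular, so regularity is not part of the definition.
\<close>

definition haar_prob :: "'a::topological_ab_group_add measure \<Rightarrow> bool" where
  "haar_prob \<mu> \<longleftrightarrow>
     prob_space \<mu> \<and> sets \<mu> = sets borel \<and>
     (\<forall>g. \<forall>A\<in>sets borel. emeasure \<mu> ((\<lambda>x. g + x) ` A) = emeasure \<mu> A)"

text \<open>
  \<open>- \<integral> f log f d\<mu>\<close> for a probability density \<open>f\<close>, split into the positive and the negative part of
  the integrand (\<^const>\<open>ennreal\<close> maps negative numbers to 0). As \<open>- t ln t \<le> 1/e\<close> for \<open>t \<ge> 0\<close>,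
  the first integral is finite when \<open>\<mu>\<close> is finite, so the difference is never \<open>\<infinity> - \<infinity>\<close>, and its
  value is \<open>- \<infinity>\<close> exactly if \<open>f log f\<close> is not integrable.
\<close>

definition density_entropy :: "'a measure \<Rightarrow> ('a \<Rightarrow> real) \<Rightarrow> ereal" where
  "density_entropy \<mu> f =
     enn2ereal (\<integral>\<^sup>+x. ennreal (- (f x * ln (f x))) \<partial>\<mu>)
     - enn2ereal (\<integral>\<^sup>+x. ennreal (f x * ln (f x)) \<partial>\<mu>)"

text \<open>
  The entropy \<open>h(X)\<close> with respect to \<open>\<mu>\<close> of a random variable \<open>X\<close> defined on the probability
  space \<open>M\<close>. Densities are unique almost everywhere, and \<^const>\<open>RN_deriv\<close> picks one if there is any.
\<close>

definition rv_entropy :: "'a measure \<Rightarrow> 'b measure \<Rightarrow> ('b \<Rightarrow> 'a) \<Rightarrow> ereal" where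
  "rv_entropy \<mu> M X =
     (if \<exists>f. distributed M \<mu> X f
      then density_entropy \<mu> (\<lambda>x. enn2real (RN_deriv \<mu> (distr M \<mu> X) x))
      else - \<infinity>)"

text \<open>
  The independent copies \<open>X', Y'\<close> are the coordinate projections on the product of the two laws.
  \<open>X\<close> and \<open>Y\<close> may live on different probability spaces. The value is only meaningful if both
  entropies are finite.
\<close>

definition ruzsa_dist ::
  "'a::ab_group_add measure \<Rightarrow> 'b measure \<Rightarrow> ('b \<Rightarrow> 'a) \<Rightarrow> 'c measure \<Rightarrow> ('c \<Rightarrow> 'a) \<Rightarrow> ereal" where
  "ruzsa_dist \<mu> M X N Y =
     rv_entropy \<mu> (distr M \<mu> X \<Otimes>\<^sub>M distr N \<mu> Y) (\<lambda>(x, y). x - y)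
     - ereal (1/2) * rv_entropy \<mu> M X - ereal (1/2) * rv_entropy \<mu> N Y"

definition binary_entropy :: "real \<Rightarrow> real" where
  "binary_entropy p = - p * ln p - (1 - p) * ln (1 - p)"

text \<open>The Minkowski difference \<open>S - S\<close>; on sets, the symbol \<open>-\<close> is the set-theoretic difference.\<close>

definition self_diff :: "'a::ab_group_add set \<Rightarrow> 'a set" where
  "self_diff S = {s - s' | s s'. s \<in> S \<and> s' \<in> S}"

definition uniformly_distributed ::
  "'a measure \<Rightarrow> 'a set \<Rightarrow> 'b measure \<Rightarrow> ('b \<Rightarrow> 'a) \<Rightarrow> bool" where
  "uniformly_distributed \<mu> S M U \<longleftrightarrow>
     distributed M \<mu> U (\<lambda>x. indicator S x / emeasure \<mu> S)"

end

theory Submission imports Defs begin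

text \<open>
  Let \<open>f\<close>, \<open>g\<close>, \<open>k\<close> be densities of \<open>X\<close>, \<open>Y\<close>, \<open>X - Y\<close> and let \<open>D x\<close> be the relative entropy of the law
  of \<open>x - Y\<close> with respect to that of \<open>X - Y\<close>, so that \<open>E (D X) = h(X - Y) - h(Y) \<le> 2 d\<close> for
  \<open>d = d\<^sub>R(X, Y)\<close>. If \<open>D \<le> t\<close> on \<open>S\<close>, then \<open>h(U\<^sub>S - Y) - h(Y) \<le> t\<close>, as the mean of the relative
  entropies of the laws of \<open>x - Y\<close> is smallest with respect to their mixture. Conditioning \<open>X\<close> on \<open>S\<close> and on its
  complement bounds \<open>h(Y) - ln \<mu>(S)\<close> from above by \<open>(2 d + H\<^sub>2(p)) / p\<close> where \<open>p = P(X \<in> S)\<close>.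
  For \<open>z \<in> S - S\<close>, Jensen's inequality gives \<open>\<integral> k(w) k(z + w) dw \<ge> exp (- 2 t - h(Y))\<close>, and
  integrating over \<open>z\<close> bounds \<open>\<mu>(S - S)\<close>.

  A single \<open>S\<close> must serve all \<open>C\<close>. For \<open>d > 0\<close> take the \<open>C\<close> that minimises
  \<open>(C + 2) d + H\<^sub>2(1 - 2 / C)\<close> and a closed subset of \<open>{D \<le> C d}\<close> which \<open>X\<close> hits with probability at
  least \<open>1 - 2 / C\<close>. For \<open>d = 0\<close> the set \<open>{D = 0}\<close> carries the whole law of \<open>X\<close> and is a coset of
  positive measure, hence closed.
\<close>

section \<open>Topology and inner regularity\<close>

text \<open>A compact metric space is totally bounded, so for each \<open>n\<close> finitely many
  balls of radius \<open>1 / (n + 1)\<close> cover it. All these balls together form a countable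
  base.\<close>

lemma countable_base_compact_metrizable:
  assumes "compact (UNIV :: 'a::topological_space set)"
    and "metrizable_space (euclidean :: 'a::topological_space topology)"
  obtains B :: "'a::topological_space set set" where "countable B" "\<And>b. b \<in> B \<Longrightarrow> open b"
    "\<And>U x. open U \<Longrightarrow> x \<in> U \<Longrightarrow> \<exists>b\<in>B. x \<in> b \<and> b \<subseteq> U"
proof -
  obtain M :: "'a set" and d where M: "Metric_space M d" and eu: "euclidean = Metric_space.mtopology M d"
    using assms(2) unfolding metrizable_space_def by blast
  interpret Metric_space M d by (rule M)
  have M_UNIV: "M = (UNIV :: 'a set)"
    using eu topspace_mtopology topspace_euclidean by metis
  have "mtotally_bounded (UNIV :: 'a set)"
    using assms(1) eu compactin_imp_mtotally_bounded compactin_euclidean_iff by metis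
  then have "\<exists>K. finite K \<and> (\<Union>x\<in>K. mball x (1 / real (Suc n))) = UNIV" for n
  proof -
    have "1 / real (Suc n) > 0" by simp
    then obtain K where "finite K \<and> UNIV \<subseteq> (\<Union>x\<in>K. mball x (1 / real (Suc n)))"
      using \<open>mtotally_bounded UNIV\<close> unfolding mtotally_bounded_def by meson
    then show ?thesis by (intro exI[of _ K]) auto
  qed
  then obtain K where K: "\<And>n. finite (K n)" "\<And>n. (\<Union>x\<in>K n. mball x (1 / real (Suc n))) = UNIV"
    by metis
  show ?thesis
  proof (rule that[of "\<Union>n. (\<lambda>x. mball x (1 / real (Suc n))) ` K n"])
    show "countable (\<Union>n. (\<lambda>x. mball x (1 / real (Suc n))) ` K n)"
      by (rule countable_UN) (use K(1) in \<open>auto intro: countable_finite\<close>)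
    show "open b" if "b \<in> (\<Union>n. (\<lambda>x. mball x (1 / real (Suc n))) ` K n)" for b
      using that eu by (auto simp: open_openin)
    fix U :: "'a set" and x assume "open U" "x \<in> U"
    then obtain r where r: "r > 0" "mball x r \<subseteq> U"
      using eu by (metis open_openin openin_mtopology)
    obtain n where n: "1 / real (Suc n) < r / 2"
      using r(1) by (meson half_gt_zero nat_approx_posE)
    obtain y where y: "y \<in> K n" "x \<in> mball y (1 / real (Suc n))"
      using K(2)[of n] by blast
    have "mball y (1 / real (Suc n)) \<subseteq> mball x r"
    proof
      fix z assume "z \<in> mball y (1 / real (Suc n))"
      then have "d y z < r / 2" "d x y < r / 2"
        using y(2) n commute[of x y] by (auto simp: in_mball)
      moreover have "d x z \<le> d x y + d y z"
        using triangle[of x y z] M_UNIV by simp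
      ultimately have "d x z < r" by simp
      then show "z \<in> mball x r"
        unfolding in_mball by (simp add: M_UNIV)
    qed
    then show "\<exists>b\<in>\<Union>n. (\<lambda>x. mball x (1 / real (Suc n))) ` K n. x \<in> b \<and> b \<subseteq> U"
      using y r(2) by (intro bexI[of _ "mball y (1 / real (Suc n))"]) auto
  qed
qed

text \<open>Continuity alone gives measurability for the Borel sets of the product space. The
  countable base writes the preimage of an open set as a countable union of open rectangles, which
  puts it into the product sigma-algebra.\<close>

lemma measurable_diff_compact_metrizable:
  assumes "compact (UNIV :: 'a::topological_ab_group_add set)"
    and "metrizable_space (euclidean :: 'a::topological_ab_group_add topology)"
  shows "(\<lambda>(x, y). x - y) \<in> borel \<Otimes>\<^sub>M borel \<rightarrow>\<^sub>M (borel :: 'a::topological_ab_group_add measure)"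
proof (rule borel_measurableI)
  fix U :: "'a set" assume U: "open U"
  obtain B :: "'a set set" where B: "countable B" "\<And>b. b \<in> B \<Longrightarrow> open b"
    "\<And>U x. open U \<Longrightarrow> x \<in> U \<Longrightarrow> \<exists>b\<in>B. x \<in> b \<and> b \<subseteq> U"
    using countable_base_compact_metrizable[OF assms] by metis
  define P where "P = {p \<in> B \<times> B. fst p \<times> snd p \<subseteq> (\<lambda>(x, y). x - y) -` U}"
  have "(\<lambda>(x, y). x - y) -` U \<subseteq> (\<Union>p\<in>P. fst p \<times> snd p)"
  proof
    fix z assume "z \<in> (\<lambda>(x, y). x - y) -` U"
    then obtain x y where z: "z = (x, y)" "x - y \<in> U" by (cases z) auto
    have "((\<lambda>z. fst z + - snd z) \<longlongrightarrow> x + - y) (nhds x \<times>\<^sub>F nhds y)"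
      by (intro tendsto_add tendsto_minus filterlim_fst filterlim_snd)
    then have "\<forall>\<^sub>F z in nhds x \<times>\<^sub>F nhds y. fst z + - snd z \<in> U"
      using U z(2) by (auto dest: topological_tendstoD)
    then obtain V W where VW: "open V" "x \<in> V" "open W" "y \<in> W"
      "\<And>a b. a \<in> V \<Longrightarrow> b \<in> W \<Longrightarrow> a - b \<in> U"
      by (smt (verit) eventually_prod_filter eventually_nhds fst_conv snd_conv uminus_add_conv_diff add.commute)
    obtain V' W' where "V' \<in> B" "x \<in> V'" "V' \<subseteq> V" "W' \<in> B" "y \<in> W'" "W' \<subseteq> W"
      using B(3) VW by meson
    moreover from this have "a - b \<in> U" if "a \<in> V'" "b \<in> W'" for a b
      using that VW(5) by (meson subsetD)
    ultimately have "(V', W') \<in> P" "z \<in> V' \<times> W'"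
      using z by (auto simp: P_def)
    then show "z \<in> (\<Union>p\<in>P. fst p \<times> snd p)" by force
  qed
  then have "(\<lambda>(x, y). x - y) -` U = (\<Union>p\<in>P. fst p \<times> snd p)"
    by (auto simp: P_def)
  moreover have "countable P"
    unfolding P_def using B(1) by (intro countable_subset[OF _ countable_SIGMA]) auto
  moreover have "fst p \<times> snd p \<in> sets (borel \<Otimes>\<^sub>M borel)" if "p \<in> P" for p
    using that B(2) by (auto simp: P_def intro!: pair_measureI)
  ultimately show "(\<lambda>(x, y). x - y) -` U \<inter> space (borel \<Otimes>\<^sub>M borel) \<in> sets (borel \<Otimes>\<^sub>M borel)"
    by (auto simp: space_pair_measure intro!: sets.countable_UN')
qed

text \<open>The sets that can be squeezed between a closed and an open set up to arbitrarily small
  measure form a sigma-algebra. It contains the open sets because these are F-sigma in a metrizable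
  space. The outer open set is carried along since complements exchange the two sides.\<close>

lemma closed_inner_approx:
  fixes \<nu> :: "'a::topological_space measure"
  assumes "metrizable_space (euclidean :: 'a topology)"
    and "finite_measure \<nu>" and sets_eq: "sets \<nu> = sets borel"
    and A: "A \<in> sets borel" and e: "e > 0"
  obtains F where "closed F" "F \<subseteq> A" "measure \<nu> F > measure \<nu> A - e"
proof -
  interpret finite_measure \<nu> by fact
  have sp: "space \<nu> = UNIV"
    using sets_eq_imp_space_eq[OF sets_eq] by simp
  have "\<forall>e>0. \<exists>F U. closed F \<and> open U \<and> F \<subseteq> A \<and> A \<subseteq> U \<and> measure \<nu> (U - F) < e"
  proof -
    have "A \<in> sigma_sets UNIV {S. open S}"
      using A by (simp add: borel_def)
    then show ?thesis
    proof (induction rule: sigma_sets.induct)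
      case (Basic a)
      then have op: "open a" by simp
      then obtain C where C: "\<And>n::nat. closed (C n)" "\<And>n. C n \<subseteq> C (Suc n)" "(\<Union>n. C n) = a"
        using open_imp_fsigma_in[OF assms(1), of a]
        unfolding fsigma_in_ascending by (metis closed_closedin open_openin)
      have "(\<lambda>n. measure \<nu> (C n)) \<longlonglongrightarrow> measure \<nu> (\<Union>n. C n)"
        using C by (intro finite_Lim_measure_incseq) (auto simp: sets_eq incseq_Suc_iff)
      show ?case
      proof (intro allI impI)
        fix e :: real assume "e > 0"
        then have "\<forall>\<^sub>F n in sequentially. measure \<nu> (C n) > measure \<nu> a - e"
          using \<open>_ \<longlonglongrightarrow> measure \<nu> (\<Union>n. C n)\<close> C(3) by (intro order_tendstoD) auto
        then obtain n where n: "measure \<nu> (C n) > measure \<nu> a - e"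
          by (meson eventually_happens' sequentially_bot)
        moreover have "measure \<nu> (a - C n) = measure \<nu> a - measure \<nu> (C n)"
          using C op by (intro finite_measure_Diff) (auto simp: sets_eq)
        ultimately show "\<exists>F U. closed F \<and> open U \<and> F \<subseteq> a \<and> a \<subseteq> U \<and> measure \<nu> (U - F) < e"
          using C op by (intro exI[of _ "C n"] exI[of _ a]) auto
      qed
    next
      case Empty
      show ?case by (intro allI impI exI[of _ "{}"]) auto
    next
      case (Compl a)
      show ?case
      proof (intro allI impI)
        fix e :: real assume "e > 0"
        then obtain F U where FU: "closed F" "open U" "F \<subseteq> a" "a \<subseteq> U" "measure \<nu> (U - F) < e"
          using Compl.IH[rule_format, of e] by metis
        have "- F - - U = U - F" by blast
        then have "closed (- U) \<and> open (- F) \<and> - U \<subseteq> UNIV - a \<and> UNIV - a \<subseteq> - F \<and> measure \<nu> (- F - - U) < e"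
          using FU by (metis Compl_anti_mono Compl_eq_Diff_UNIV closed_Compl open_Compl)
        then show "\<exists>F U. closed F \<and> open U \<and> F \<subseteq> UNIV - a \<and> UNIV - a \<subseteq> U \<and> measure \<nu> (U - F) < e"
          by blast
      qed
    next
      case (Union a)
      show ?case
      proof (intro allI impI)
        fix e :: real assume e: "e > 0"
        \<comment> \<open>The errors of the individual sets add up to \<open>e / 2\<close>. The
          other half pays for cutting the union of the \<open>F n\<close> down to a finite one,
          which is again closed.\<close>
        define \<delta> where "\<delta> n = e / 2 * (1 / 2) ^ Suc n" for n
        have \<delta>: "\<delta> n > 0" for n using e by (simp add: \<delta>_def)
        have "\<exists>F U. closed F \<and> open U \<and> F \<subseteq> a n \<and> a n \<subseteq> U \<and> measure \<nu> (U - F) < \<delta> n" for n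
          using Union.IH[of n] \<delta> by blast
        then obtain F U where FU: "\<And>n. closed (F n)" "\<And>n. open (U n)" "\<And>n. F n \<subseteq> a n"
            "\<And>n. a n \<subseteq> U n" "\<And>n. measure \<nu> (U n - F n) < \<delta> n"
          by metis
        define G where "G n = (\<Union>i\<le>n. F i)" for n
        have G: "closed (G n)" for n unfolding G_def by (intro closed_UN) (auto simp: FU)
        have \<delta>_sums: "\<delta> sums (e / 2)"
          unfolding \<delta>_def using sums_mult[OF power_half_series, of "e/2"] by simp
        have sm: "summable (\<lambda>n. measure \<nu> (U n - F n))"
          using \<delta>_sums FU(5) by (intro summable_comparison_test[OF _ sums_summable[OF \<delta>_sums]])
            (auto intro!: exI[of _ 0] less_imp_le)
        have "measure \<nu> (\<Union>n. U n - F n) \<le> (\<Sum>n. measure \<nu> (U n - F n))"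
          using FU sm by (intro finite_measure_subadditive_countably) (auto simp: sets_eq)
        also have "\<dots> \<le> e / 2"
          using suminf_le[of "\<lambda>n. measure \<nu> (U n - F n)" \<delta>] FU(5) sm \<delta>_sums
          by (simp add: sums_iff less_imp_le)
        finally have 1: "measure \<nu> (\<Union>n. U n - F n) \<le> e / 2" .
        have "(\<lambda>n. measure \<nu> (G n)) \<longlonglongrightarrow> measure \<nu> (\<Union>n. G n)"
          using G by (intro finite_Lim_measure_incseq)
            (auto simp: sets_eq incseq_def G_def intro: order_trans)
        then have "\<forall>\<^sub>F n in sequentially. measure \<nu> (G n) > measure \<nu> (\<Union>n. G n) - e / 2"
          using e by (intro order_tendstoD) auto
        then obtain n where n: "measure \<nu> (G n) > measure \<nu> (\<Union>n. G n) - e / 2"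
          by (meson eventually_happens' sequentially_bot)
        have 2: "measure \<nu> ((\<Union>n. G n) - G n) < e / 2"
          using n G by (subst finite_measure_Diff) (auto simp: sets_eq)
        have GF: "(\<Union>n. G n) = (\<Union>n. F n)"
          by (auto simp: G_def)
        have "measure \<nu> ((\<Union>n. U n) - G n) \<le> measure \<nu> ((\<Union>n. U n - F n) \<union> ((\<Union>n. G n) - G n))"
          using FU G unfolding GF by (intro finite_measure_mono) (auto simp: sets_eq)
        also have "\<dots> \<le> measure \<nu> (\<Union>n. U n - F n) + measure \<nu> ((\<Union>n. G n) - G n)"
          using FU G by (intro measure_Un_le) (auto simp: sets_eq)
        also have "\<dots> < e" using 1 2 by simp
        finally have "measure \<nu> ((\<Union>n. U n) - G n) < e" .
        moreover have "open (\<Union>n. U n)" "(\<Union>i. a i) \<subseteq> (\<Union>n. U n)" "G n \<subseteq> (\<Union>i. a i)"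
          using FU(2-4) by (auto simp: G_def) (meson subsetD)+
        ultimately show "\<exists>F U. closed F \<and> open U \<and> F \<subseteq> (\<Union>i. a i) \<and> (\<Union>i. a i) \<subseteq> U \<and> measure \<nu> (U - F) < e"
          using G[of n] by metis
      qed
    qed
  qed
  then obtain F U where FU: "closed F" "open U" "F \<subseteq> A" "A \<subseteq> U" "measure \<nu> (U - F) < e"
    using e by meson
  have [measurable]: "F \<in> sets \<nu>" "U \<in> sets \<nu>" "A \<in> sets \<nu>"
    using FU(1,2) A by (auto simp: sets_eq)
  have "measure \<nu> A - measure \<nu> F = measure \<nu> (A - F)"
    using FU(3) by (subst finite_measure_Diff) auto
  also have "\<dots> \<le> measure \<nu> (U - F)"
    using FU(4) by (intro finite_measure_mono) auto
  finally have "measure \<nu> F > measure \<nu> A - e" using FU(5) by simp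
  then show ?thesis using FU(1,3) that by blast
qed

section \<open>Relative entropy of mixtures\<close>

definition xlnx :: "real \<Rightarrow> real" where
  "xlnx t = t * ln t"

text \<open>The integrand of relative entropy, with the terms \<open>- a + b\<close> (which cancel for probability
  densities) making it pointwise nonnegative, so that Tonelli's theorem applies without any
  integrability assumption. Note \<open>ln 0 = 0\<close>.\<close>

definition kl_term :: "real \<Rightarrow> real \<Rightarrow> ennreal" where
  "kl_term a b = (if b = 0 \<and> a \<noteq> 0 then \<infinity> else ennreal (xlnx a - a * ln b - a + b))"

lemma xlnx_measurable [measurable]: "xlnx \<in> borel_measurable borel"
  unfolding xlnx_def by measurable

lemma kl_term_measurable [measurable (raw)]:
  assumes [measurable]: "f \<in> borel_measurable M" "g \<in> borel_measurable M"
  shows "(\<lambda>x. kl_term (f x) (g x)) \<in> borel_measurable M"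
  unfolding kl_term_def by measurable

lemma xlnx_0 [simp]: "xlnx 0 = 0"
  by (simp add: xlnx_def)

text \<open>The function \<open>a * ln b + a - b\<close> of \<open>a\<close> is the tangent to the
  convex \<open>xlnx\<close> at \<open>b\<close>. Every use of Jensen's inequality for
  \<open>xlnx\<close> below comes from integrating this.\<close>

lemma xlnx_tangent:
  assumes "a \<ge> 0" "b > 0"
  shows "0 \<le> xlnx a - a * ln b - a + b"
proof (cases "a = 0")
  case False
  then have "ln (b / a) \<le> b / a - 1" using assms by (intro ln_le_minus_one) auto
  then have "a * ln (b / a) \<le> a * (b / a - 1)" using assms by (intro mult_left_mono)
  then show ?thesis using assms False by (simp add: xlnx_def ln_div algebra_simps)
qed (use assms in auto)

lemma xlnx_tangent_eq:
  assumes "a \<ge> 0" "b > 0" "xlnx a - a * ln b - a + b = 0"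
  shows "a = b"
proof (cases "a = 0")
  case False
  then have a: "a > 0" using assms by simp
  then have "a * ln (b / a) = a * (b / a - 1)"
    using assms by (simp add: xlnx_def ln_div algebra_simps)
  then have "ln (b / a) = b / a - 1" using a by simp
  then have "b / a = 1" using a assms by (intro ln_eq_minus_one) auto
  then show ?thesis using a by simp
qed (use assms in auto)

lemma xlnx_ge: "t \<ge> 0 \<Longrightarrow> - 1 \<le> xlnx t"
  using xlnx_tangent[of t 1] by (cases "t \<le> 1") (auto simp: xlnx_def intro: order_trans[of _ 0])

lemma kl_term_pos: "b > 0 \<Longrightarrow> kl_term a b = ennreal (xlnx a - a * ln b - a + b)"
  by (auto simp: kl_term_def)

lemma kl_term_self: "a \<ge> 0 \<Longrightarrow> kl_term a a = 0"
  by (auto simp: kl_term_def xlnx_def)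

lemma kl_term_eq_0:
  assumes "a \<ge> 0" "b \<ge> 0" "kl_term a b = 0"
  shows "a = b"
proof (cases "b = 0")
  case False
  then have "b > 0" using assms by simp
  moreover from this have "xlnx a - a * ln b - a + b = 0"
    using assms xlnx_tangent[of a b] by (simp add: kl_term_pos ennreal_eq_0_iff)
  ultimately show ?thesis using xlnx_tangent_eq[of a b] assms by simp
qed (use assms in \<open>auto simp: kl_term_def split: if_splits\<close>)

text \<open>Jensen's inequality is the tangent inequality at the mean, averaged. For
  \<open>b > 0\<close> the identity is linearity of expectation, and Jensen makes both summands
  nonnegative, so that \<open>ennreal\<close> may be distributed over the sum. For
  \<open>b = 0\<close> both sides are infinite unless \<open>v\<close> vanishes almost
  everywhere.\<close>

lemma (in prob_space)
  fixes v :: "'a \<Rightarrow> real"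
  assumes v: "\<And>x. 0 \<le> v x" "integrable M v" and Lv: "integrable M (\<lambda>x. xlnx (v x))"
  shows xlnx_expectation_le: "xlnx (expectation v) \<le> expectation (\<lambda>x. xlnx (v x))"
    and nn_integral_kl_term: "b \<ge> 0 \<Longrightarrow> (\<integral>\<^sup>+x. kl_term (v x) b \<partial>M) =
      ennreal (expectation (\<lambda>x. xlnx (v x)) - xlnx (expectation v)) + kl_term (expectation v) b"
proof -
  define t where "t = expectation v"
  have t: "t \<ge> 0" unfolding t_def using v(1) by (simp add: Bochner_Integration.integral_nonneg)
  have [measurable]: "v \<in> borel_measurable M" using v(2) by auto
  have int: "integrable M (\<lambda>x. xlnx (v x) - v x * c - v x + b)" for b c
    using v(2) Lv by (intro Bochner_Integration.integrable_add Bochner_Integration.integrable_diff) auto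
  have eq: "expectation (\<lambda>x. xlnx (v x) - v x * c - v x + b)
      = expectation (\<lambda>x. xlnx (v x)) - t * c - t + b" for b c
    using v(2) Lv by (simp add: t_def prob_space)
  have v0: "AE x in M. v x = 0" if "t = 0"
    using that v integral_nonneg_eq_0_iff_AE[of M v] by (simp add: t_def)
  have jensen: "xlnx t \<le> expectation (\<lambda>x. xlnx (v x))"
  proof (cases "t = 0")
    case True
    then have "expectation (\<lambda>x. xlnx (v x)) = expectation (\<lambda>x. 0)"
      using v0 by (intro integral_cong_AE) auto
    then show ?thesis using True by simp
  next
    case False
    then have "0 \<le> expectation (\<lambda>x. xlnx (v x) - v x * ln t - v x + t)"
      using t v(1) by (intro Bochner_Integration.integral_nonneg xlnx_tangent) auto
    then show ?thesis unfolding eq by (simp add: xlnx_def)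
  qed
  then show "xlnx (expectation v) \<le> expectation (\<lambda>x. xlnx (v x))"
    by (simp add: t_def)
  assume b: "b \<ge> 0"
  have "(\<integral>\<^sup>+x. kl_term (v x) b \<partial>M) = ennreal (expectation (\<lambda>x. xlnx (v x)) - xlnx t) + kl_term t b"
  proof (cases "b = 0")
    case False
    then have "b > 0" using b by simp
    then have "(\<integral>\<^sup>+x. kl_term (v x) b \<partial>M) = ennreal (expectation (\<lambda>x. xlnx (v x)) - t * ln b - t + b)"
      unfolding kl_term_pos[OF \<open>b > 0\<close>] eq[symmetric]
      using int xlnx_tangent v(1) by (intro nn_integral_eq_integral) auto
    also have "\<dots> = ennreal ((expectation (\<lambda>x. xlnx (v x)) - xlnx t) + (xlnx t - t * ln b - t + b))"
      by (intro arg_cong[of _ _ ennreal]) simp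
    also have "\<dots> = ennreal (expectation (\<lambda>x. xlnx (v x)) - xlnx t) + kl_term t b"
      using jensen xlnx_tangent[OF t \<open>b > 0\<close>] \<open>b > 0\<close> by (subst ennreal_plus) (auto simp: kl_term_pos)
    finally show ?thesis .
  next
    case True
    show ?thesis
    proof (cases "t = 0")
      case t0: True
      have "(\<integral>\<^sup>+x. kl_term (v x) b \<partial>M) = (\<integral>\<^sup>+x. 0 \<partial>M)"
        using v0[OF t0] True by (intro nn_integral_cong_AE) (auto simp: kl_term_def)
      moreover have "expectation (\<lambda>x. xlnx (v x)) = expectation (\<lambda>x. 0)"
        using v0[OF t0] by (intro integral_cong_AE) auto
      ultimately show ?thesis using True t0 by (simp add: kl_term_def)
    next
      case t0: False
      have "(\<integral>\<^sup>+x. kl_term (v x) b \<partial>M) = \<infinity>"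
      proof (rule ccontr)
        assume "(\<integral>\<^sup>+x. kl_term (v x) b \<partial>M) \<noteq> \<infinity>"
        then have "AE x in M. kl_term (v x) b \<noteq> \<infinity>"
          by (intro nn_integral_PInf_AE) auto
        then have "AE x in M. v x = 0"
          by eventually_elim (use True in \<open>auto simp: kl_term_def split: if_splits\<close>)
        then have "t = expectation (\<lambda>x. 0)"
          unfolding t_def by (intro integral_cong_AE) auto
        then show False using t0 by simp
      qed
      then show ?thesis using True t0 by (simp add: kl_term_def)
    qed
  qed
  then show "(\<integral>\<^sup>+x. kl_term (v x) b \<partial>M) =
      ennreal (expectation (\<lambda>x. xlnx (v x)) - xlnx (expectation v)) + kl_term (expectation v) b"
    by (simp add: t_def)
qed

text \<open>As \<open>xlnx\<close> is at least \<open>- 1\<close> on nonnegative numbers and the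
  measure is finite, an integrable upper bound is enough.\<close>

lemma (in finite_measure) integrable_xlnx_le:
  fixes v :: "'a \<Rightarrow> real"
  assumes [measurable]: "v \<in> borel_measurable M" and "\<And>x. 0 \<le> v x"
    and J: "integrable M J" "AE x in M. xlnx (v x) \<le> J x"
  shows "integrable M (\<lambda>x. xlnx (v x))"
proof (rule Bochner_Integration.integrable_bound)
  show "integrable M (\<lambda>x. 1 + \<bar>J x\<bar>)" using J(1) by auto
  show "AE x in M. norm (xlnx (v x)) \<le> norm (1 + \<bar>J x\<bar>)"
    using J(2) assms(2) xlnx_ge by (auto elim!: eventually_mono simp: abs_le_iff) (smt (verit) xlnx_ge)
qed measurable

text \<open>The section of \<open>F\<close> at \<open>x\<close> stands for the density of a law
  indexed by \<open>x\<close>, and \<open>P\<close> is the law of the index. For the difference of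
  two independent variables, either of them can serve as the index.\<close>

locale kernel_mixture = P: prob_space P + Q: finite_measure Q
  for P :: "'a measure" and Q :: "'b measure" +
  fixes F :: "'a \<times> 'b \<Rightarrow> real"
  assumes F_nonneg: "0 \<le> F z"
    and F_int: "integrable (P \<Otimes>\<^sub>M Q) F"
    and LF_int: "integrable (P \<Otimes>\<^sub>M Q) (\<lambda>z. xlnx (F z))"
begin

sublocale PQ: pair_sigma_finite P Q ..

definition mix :: "'b \<Rightarrow> real" where
  "mix w = (\<integral>x. F (x, w) \<partial>P)"

lemma F_measurable [measurable]: "F \<in> borel_measurable (P \<Otimes>\<^sub>M Q)"
  using F_int by auto

lemma mix_measurable [measurable]: "mix \<in> borel_measurable Q"
  unfolding mix_def by measurable

lemma mix_nonneg: "0 \<le> mix w"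
  unfolding mix_def by (intro Bochner_Integration.integral_nonneg F_nonneg)

lemma AE_int: "AE w in Q. integrable P (\<lambda>x. F (x, w))"
  "AE w in Q. integrable P (\<lambda>x. xlnx (F (x, w)))"
  using PQ.AE_integrable_snd[of "\<lambda>x w. F (x, w)"] PQ.AE_integrable_snd[of "\<lambda>x w. xlnx (F (x, w))"]
    F_int LF_int by (auto simp: case_prod_beta')

lemma LF_snd: "integrable Q (\<lambda>w. \<integral>x. xlnx (F (x, w)) \<partial>P)"
  "(\<integral>w. (\<integral>x. xlnx (F (x, w)) \<partial>P) \<partial>Q) = (\<integral>z. xlnx (F z) \<partial>(P \<Otimes>\<^sub>M Q))"
  using PQ.integrable_snd[of "\<lambda>x w. xlnx (F (x, w))"] PQ.integral_snd[of "\<lambda>x w. xlnx (F (x, w))"] LF_int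
  by (auto simp: case_prod_beta')

lemma xlnx_mix_le: "AE w in Q. xlnx (mix w) \<le> (\<integral>x. xlnx (F (x, w)) \<partial>P)"
  using AE_int unfolding mix_def
  by eventually_elim (intro P.xlnx_expectation_le F_nonneg)

lemma xlnx_mix_integrable: "integrable Q (\<lambda>w. xlnx (mix w))"
  by (rule Q.integrable_xlnx_le[OF mix_measurable mix_nonneg LF_snd(1) xlnx_mix_le])

lemma integral_xlnx_mix_le: "(\<integral>w. xlnx (mix w) \<partial>Q) \<le> (\<integral>z. xlnx (F z) \<partial>(P \<Otimes>\<^sub>M Q))"
  unfolding LF_snd(2)[symmetric]
  by (intro integral_mono_AE xlnx_mix_integrable LF_snd(1) xlnx_mix_le)

text \<open>Integrate \<open>nn_integral_kl_term\<close> over \<open>w\<close>, after exchanging the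
  integrals. The first summand does not depend on \<open>b\<close>, hence the mean relative entropy
  to a reference \<open>b\<close> is least when \<open>b\<close> is the mixture itself.\<close>

lemma compensation:
  assumes [measurable]: "b \<in> borel_measurable Q" and b: "\<And>w. 0 \<le> b w"
  shows "(\<integral>\<^sup>+x. (\<integral>\<^sup>+w. kl_term (F (x, w)) (b w) \<partial>Q) \<partial>P) =
    ennreal ((\<integral>z. xlnx (F z) \<partial>(P \<Otimes>\<^sub>M Q)) - (\<integral>w. xlnx (mix w) \<partial>Q)) + (\<integral>\<^sup>+w. kl_term (mix w) (b w) \<partial>Q)"
proof -
  have "(\<integral>\<^sup>+x. (\<integral>\<^sup>+w. kl_term (F (x, w)) (b w) \<partial>Q) \<partial>P) = (\<integral>\<^sup>+w. (\<integral>\<^sup>+x. kl_term (F (x, w)) (b w) \<partial>P) \<partial>Q)"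
    by (intro PQ.Fubini'[symmetric]) measurable
  also have "\<dots> = (\<integral>\<^sup>+w. ennreal ((\<integral>x. xlnx (F (x, w)) \<partial>P) - xlnx (mix w)) + kl_term (mix w) (b w) \<partial>Q)"
  proof (intro nn_integral_cong_AE)
    show "AE w in Q. (\<integral>\<^sup>+x. kl_term (F (x, w)) (b w) \<partial>P) =
      ennreal ((\<integral>x. xlnx (F (x, w)) \<partial>P) - xlnx (mix w)) + kl_term (mix w) (b w)"
      using AE_int unfolding mix_def
      by eventually_elim (intro P.nn_integral_kl_term F_nonneg b)
  qed
  also have "\<dots> = (\<integral>\<^sup>+w. ennreal ((\<integral>x. xlnx (F (x, w)) \<partial>P) - xlnx (mix w)) \<partial>Q) + (\<integral>\<^sup>+w. kl_term (mix w) (b w) \<partial>Q)"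
    by (intro nn_integral_add) measurable
  also have "(\<integral>\<^sup>+w. ennreal ((\<integral>x. xlnx (F (x, w)) \<partial>P) - xlnx (mix w)) \<partial>Q) =
      ennreal (\<integral>w. (\<integral>x. xlnx (F (x, w)) \<partial>P) - xlnx (mix w) \<partial>Q)"
    using xlnx_mix_le by (intro nn_integral_eq_integral Bochner_Integration.integrable_diff LF_snd(1) xlnx_mix_integrable) auto
  also have "(\<integral>w. (\<integral>x. xlnx (F (x, w)) \<partial>P) - xlnx (mix w) \<partial>Q) =
      (\<integral>z. xlnx (F z) \<partial>(P \<Otimes>\<^sub>M Q)) - (\<integral>w. xlnx (mix w) \<partial>Q)"
    by (simp add: LF_snd xlnx_mix_integrable)
  finally show ?thesis .
qed

end

section \<open>Densities on a group with Haar measure\<close>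

text \<open>Of the topology, only the measurability of subtraction for the product sigma-algebra is
  retained here. Topological arguments return when a closed set has to be chosen.\<close>

locale haar_group = prob_space \<mu> for \<mu> :: "'a::ab_group_add measure" +
  assumes space_UNIV [simp]: "space \<mu> = UNIV"
    and diff_measurable': "(\<lambda>(x, y). x - y) \<in> \<mu> \<Otimes>\<^sub>M \<mu> \<rightarrow>\<^sub>M \<mu>"
    and shift: "A \<in> sets \<mu> \<Longrightarrow> emeasure \<mu> ((\<lambda>x. g + x) ` A) = emeasure \<mu> A"
begin

sublocale pair: pair_sigma_finite \<mu> \<mu> ..

lemma diff_measurable [measurable (raw)]:
  assumes [measurable]: "f \<in> M \<rightarrow>\<^sub>M \<mu>" "g \<in> M \<rightarrow>\<^sub>M \<mu>"
  shows "(\<lambda>x. f x - g x) \<in> M \<rightarrow>\<^sub>M \<mu>"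
proof -
  have "(\<lambda>(x, y). x - y) \<circ> (\<lambda>x. (f x, g x)) \<in> M \<rightarrow>\<^sub>M \<mu>"
    by (rule measurable_comp[OF _ diff_measurable']) measurable
  then show ?thesis by (simp add: comp_def)
qed

lemma add_measurable [measurable (raw)]:
  assumes [measurable]: "f \<in> M \<rightarrow>\<^sub>M \<mu>" "g \<in> M \<rightarrow>\<^sub>M \<mu>"
  shows "(\<lambda>x. f x + g x) \<in> M \<rightarrow>\<^sub>M \<mu>"
proof -
  have "(\<lambda>x. f x - (0 - g x)) \<in> M \<rightarrow>\<^sub>M \<mu>"
    by measurable
  then show ?thesis by simp
qed

lemma distr_shift: "distr \<mu> \<mu> (\<lambda>x. g + x) = \<mu>"
proof (rule measure_eqI)
  fix A assume "A \<in> sets (distr \<mu> \<mu> (\<lambda>x. g + x))"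
  then have A: "A \<in> sets \<mu>" by simp
  have "(\<lambda>x. g + x) -` A = (\<lambda>x. - g + x) ` A"
    by (auto simp: image_iff algebra_simps)
  then show "emeasure (distr \<mu> \<mu> (\<lambda>x. g + x)) A = emeasure \<mu> A"
    using A shift[OF A, of "- g"] by (subst emeasure_distr) auto
qed simp

lemma nn_integral_shift:
  assumes [measurable]: "f \<in> borel_measurable \<mu>"
  shows "(\<integral>\<^sup>+x. f (g + x) \<partial>\<mu>) = (\<integral>\<^sup>+x. f x \<partial>\<mu>)"
  by (subst (2) distr_shift[of g, symmetric]) (simp add: nn_integral_distr)

lemma nn_integral_reflect:
  assumes [measurable]: "f \<in> borel_measurable \<mu>"
  shows "(\<integral>\<^sup>+x. f (g - x) \<partial>\<mu>) = (\<integral>\<^sup>+x. f x \<partial>\<mu>)"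
proof -
  \<comment> \<open>Average \<open>f (y - x)\<close> over both variables: integrating out \<open>y\<close> first uses translations only.\<close>
  have refl: "(\<integral>\<^sup>+x. f (y - x) \<partial>\<mu>) = (\<integral>\<^sup>+x. f (- x) \<partial>\<mu>)" for y
    using nn_integral_shift[of "\<lambda>x. f (y - x)" y] by (simp add: algebra_simps)
  have "(\<integral>\<^sup>+x. f (- x) \<partial>\<mu>) = (\<integral>\<^sup>+y. (\<integral>\<^sup>+x. f (y - x) \<partial>\<mu>) \<partial>\<mu>)"
    by (simp add: refl emeasure_space_1[simplified])
  also have "\<dots> = (\<integral>\<^sup>+x. (\<integral>\<^sup>+y. f (y - x) \<partial>\<mu>) \<partial>\<mu>)"
    by (rule pair.Fubini') measurable
  also have "\<dots> = (\<integral>\<^sup>+x. f x \<partial>\<mu>)"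
    using nn_integral_shift[of f "- x" for x] by (simp add: emeasure_space_1[simplified])
  finally show ?thesis by (simp add: refl)
qed

lemma distr_reflect: "distr \<mu> \<mu> (\<lambda>x. g - x) = \<mu>"
proof (rule measure_eqI)
  fix A assume "A \<in> sets (distr \<mu> \<mu> (\<lambda>x. g - x))"
  then have A [measurable]: "A \<in> sets \<mu>" by simp
  have "emeasure (distr \<mu> \<mu> (\<lambda>x. g - x)) A = (\<integral>\<^sup>+x. indicator A (g - x) \<partial>\<mu>)"
    by (subst nn_integral_distr[symmetric, of _ _ \<mu>]) auto
  then show "emeasure (distr \<mu> \<mu> (\<lambda>x. g - x)) A = emeasure \<mu> A"
    by (simp add: nn_integral_reflect)
qed simp

lemma integral_shift:
  fixes f :: "'a \<Rightarrow> real"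
  assumes [measurable]: "f \<in> borel_measurable \<mu>"
  shows "(\<integral>x. f (g + x) \<partial>\<mu>) = (\<integral>x. f x \<partial>\<mu>)"
  by (subst (2) distr_shift[of g, symmetric]) (simp add: integral_distr)

lemma integral_reflect:
  fixes f :: "'a \<Rightarrow> real"
  assumes [measurable]: "f \<in> borel_measurable \<mu>"
  shows "(\<integral>x. f (g - x) \<partial>\<mu>) = (\<integral>x. f x \<partial>\<mu>)"
  by (subst (2) distr_reflect[of g, symmetric]) (simp add: integral_distr)

lemma integrable_reflect:
  fixes f :: "'a \<Rightarrow> real"
  assumes "integrable \<mu> f"
  shows "integrable \<mu> (\<lambda>x. f (g - x))"
  using assms by (subst (asm) distr_reflect[of g, symmetric], subst (asm) integrable_distr_eq) auto

section \<open>Probability densities, their entropy, and the density of a difference\<close>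

definition prob_dens :: "('a \<Rightarrow> real) \<Rightarrow> bool" where
  "prob_dens u \<longleftrightarrow> (\<forall>x. 0 \<le> u x) \<and> integrable \<mu> u \<and> (\<integral>x. u x \<partial>\<mu>) = 1"

definition ent :: "('a \<Rightarrow> real) \<Rightarrow> real" where
  "ent u = - (\<integral>x. xlnx (u x) \<partial>\<mu>)"

definition finite_ent :: "('a \<Rightarrow> real) \<Rightarrow> bool" where
  "finite_ent u \<longleftrightarrow> integrable \<mu> (\<lambda>x. xlnx (u x))"

text \<open>Given the value \<open>x\<close> of the first variable, the difference is
  \<open>w\<close> when the second one equals \<open>x - w\<close>. The Bochner integral defaults to
  0 where it diverges; for \<open>u\<close>, \<open>v\<close> as in
  \<open>nn_integral_diff_dens\<close> this concerns only a null set of \<open>w\<close>.\<close>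

definition diff_dens :: "('a \<Rightarrow> real) \<Rightarrow> ('a \<Rightarrow> real) \<Rightarrow> 'a \<Rightarrow> real" where
  "diff_dens u v w = (\<integral>x. u x * v (x - w) \<partial>\<mu>)"

lemma prob_densD:
  assumes "prob_dens u"
  shows "0 \<le> u x" "integrable \<mu> u" "u \<in> borel_measurable \<mu>" "(\<integral>x. u x \<partial>\<mu>) = 1"
    "(\<integral>\<^sup>+x. ennreal (u x) \<partial>\<mu>) = 1" "prob_space (density \<mu> u)"
proof -
  show u: "0 \<le> u x" "integrable \<mu> u" "(\<integral>x. u x \<partial>\<mu>) = 1" and [measurable]: "u \<in> borel_measurable \<mu>" for x
    using assms by (auto simp: prob_dens_def)
  show "(\<integral>\<^sup>+x. ennreal (u x) \<partial>\<mu>) = 1"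
    using u by (subst nn_integral_eq_integral) auto
  then show "prob_space (density \<mu> u)"
    by (intro prob_spaceI) (simp add: emeasure_density flip: space_UNIV)
qed

lemma prob_densI:
  assumes "u \<in> borel_measurable \<mu>" "\<And>x. 0 \<le> u x" "(\<integral>\<^sup>+x. ennreal (u x) \<partial>\<mu>) = 1"
  shows "prob_dens u"
  using assms unfolding prob_dens_def
  by (auto intro!: integrableI_nonneg simp: integral_eq_nn_integral)

text \<open>For each fixed \<open>x\<close> the map \<open>T\<close> preserves \<mu> in its second
  argument, so every component has the same integral and the same entropy as \<open>v\<close>.
  Fubini's theorem does the rest.\<close>

lemma kernel_mixture_density:
  assumes u: "prob_dens u" and v: "prob_dens v" "finite_ent v"
    and [measurable]: "T \<in> \<mu> \<Otimes>\<^sub>M \<mu> \<rightarrow>\<^sub>M \<mu>"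
    and T: "\<And>x. distr \<mu> \<mu> (\<lambda>w. T (x, w)) = \<mu>"
  shows "kernel_mixture (density \<mu> u) \<mu> (\<lambda>z. v (T z))"
    and "(\<integral>z. xlnx (v (T z)) \<partial>(density \<mu> u \<Otimes>\<^sub>M \<mu>)) = - ent v"
proof -
  interpret P: prob_space "density \<mu> u" by (rule prob_densD[OF u])
  interpret PQ: pair_sigma_finite "density \<mu> u" \<mu> ..
  have [measurable]: "v \<in> borel_measurable \<mu>" by (rule prob_densD[OF v(1)])
  have [measurable_cong]: "sets (density \<mu> u) = sets \<mu>" by simp
  have [measurable]: "T \<in> density \<mu> u \<Otimes>\<^sub>M \<mu> \<rightarrow>\<^sub>M \<mu>" by measurable
  have int: "integrable \<mu> (\<lambda>w. h (T (x, w)))" if h: "integrable \<mu> h" for h :: "'a \<Rightarrow> real" and x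
  proof -
    have [measurable]: "h \<in> borel_measurable \<mu>" using h by auto
    show ?thesis
      using h by (subst (asm) T[of x, symmetric], subst (asm) integrable_distr_eq) auto
  qed
  have eq: "h \<in> borel_measurable \<mu> \<Longrightarrow> (\<integral>w. h (T (x, w)) \<partial>\<mu>) = (\<integral>w. h w \<partial>\<mu>)" for h :: "'a \<Rightarrow> real" and x
    by (subst (2) T[of x, symmetric]) (simp add: integral_distr)
  have fub: "integrable (density \<mu> u \<Otimes>\<^sub>M \<mu>) (\<lambda>z. h (T z))" if h: "integrable \<mu> h" for h :: "'a \<Rightarrow> real"
  proof (rule PQ.Fubini_integrable)
    have [measurable]: "h \<in> borel_measurable \<mu>" using h by auto
    show "(\<lambda>z. h (T z)) \<in> borel_measurable (density \<mu> u \<Otimes>\<^sub>M \<mu>)" by measurable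
    show "AE x in density \<mu> u. integrable \<mu> (\<lambda>y. h (T (x, y)))"
      using int[OF h] by simp
    have "(\<lambda>x. \<integral>y. norm (h (T (x, y))) \<partial>\<mu>) = (\<lambda>x. \<integral>y. norm (h y) \<partial>\<mu>)"
      by (intro ext eq) measurable
    then show "integrable (density \<mu> u) (\<lambda>x. \<integral>y. norm (h (T (x, y))) \<partial>\<mu>)"
      by simp
  qed
  show "kernel_mixture (density \<mu> u) \<mu> (\<lambda>z. v (T z))"
  proof unfold_locales
    show "0 \<le> v (T z)" for z by (rule prob_densD[OF v(1)])
    show "integrable (density \<mu> u \<Otimes>\<^sub>M \<mu>) (\<lambda>z. v (T z))"
      by (rule fub[OF prob_densD(2)[OF v(1)]])
    show "integrable (density \<mu> u \<Otimes>\<^sub>M \<mu>) (\<lambda>z. xlnx (v (T z)))"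
      by (rule fub) (use v(2) in \<open>simp add: finite_ent_def\<close>)
  qed
  have "(\<integral>z. xlnx (v (T z)) \<partial>(density \<mu> u \<Otimes>\<^sub>M \<mu>)) = (\<integral>x. (\<integral>w. xlnx (v (T (x, w))) \<partial>\<mu>) \<partial>density \<mu> u)"
    using PQ.integral_fst'[OF fub, of "\<lambda>x. xlnx (v x)"] v(2) by (simp add: finite_ent_def)
  also have "\<dots> = - ent v"
    using eq[of "\<lambda>x. xlnx (v x)"] by (simp add: P.prob_space[simplified] ent_def)
  finally show "(\<integral>z. xlnx (v (T z)) \<partial>(density \<mu> u \<Otimes>\<^sub>M \<mu>)) = - ent v" .
qed

lemma kernel_mixture_minus:
  assumes "prob_dens u" "prob_dens v" "finite_ent v"
  shows "kernel_mixture (density \<mu> u) \<mu> (\<lambda>z. v (fst z - snd z))"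
    and "(\<integral>z. xlnx (v (fst z - snd z)) \<partial>(density \<mu> u \<Otimes>\<^sub>M \<mu>)) = - ent v"
    and "kernel_mixture.mix (density \<mu> u) (\<lambda>z. v (fst z - snd z)) = diff_dens u v"
proof -
  show km: "kernel_mixture (density \<mu> u) \<mu> (\<lambda>z. v (fst z - snd z))"
    and "(\<integral>z. xlnx (v (fst z - snd z)) \<partial>(density \<mu> u \<Otimes>\<^sub>M \<mu>)) = - ent v"
    using kernel_mixture_density[OF assms, of "\<lambda>z. fst z - snd z"] diff_measurable'
    by (simp_all add: distr_reflect case_prod_beta')
  note [measurable] = prob_densD(3)[OF assms(1)] prob_densD(3)[OF assms(2)]
  show "kernel_mixture.mix (density \<mu> u) (\<lambda>z. v (fst z - snd z)) = diff_dens u v"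
    unfolding kernel_mixture.mix_def[OF km] diff_dens_def
    using prob_densD(1)[OF assms(1)] by (intro ext, subst integral_real_density) auto
qed

lemma diff_dens_swap:
  assumes [measurable]: "u \<in> borel_measurable \<mu>" "v \<in> borel_measurable \<mu>"
  shows "diff_dens u v w = (\<integral>y. v y * u (w + y) \<partial>\<mu>)"
  unfolding diff_dens_def
  by (subst integral_shift[of _ w, symmetric]) (auto simp: mult.commute)

text \<open>The law of \<open>X - Y\<close> is also the mixture of the laws of \<open>X - y\<close>
  over the values \<open>y\<close> of \<open>Y\<close>. This second reading compares its entropy
  with that of \<open>u\<close> instead of \<open>v\<close>.\<close>

lemma kernel_mixture_plus:
  assumes "prob_dens u" "prob_dens v" "finite_ent u"
  shows "kernel_mixture (density \<mu> v) \<mu> (\<lambda>z. u (snd z + fst z))"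
    and "(\<integral>z. xlnx (u (snd z + fst z)) \<partial>(density \<mu> v \<Otimes>\<^sub>M \<mu>)) = - ent u"
    and "kernel_mixture.mix (density \<mu> v) (\<lambda>z. u (snd z + fst z)) = diff_dens u v"
proof -
  have T: "(\<lambda>z. snd z + fst z) \<in> \<mu> \<Otimes>\<^sub>M \<mu> \<rightarrow>\<^sub>M \<mu>"
    by measurable
  show km: "kernel_mixture (density \<mu> v) \<mu> (\<lambda>z. u (snd z + fst z))"
    and "(\<integral>z. xlnx (u (snd z + fst z)) \<partial>(density \<mu> v \<Otimes>\<^sub>M \<mu>)) = - ent u"
    using kernel_mixture_density[OF assms(2,1,3) T]
    by (simp_all add: distr_shift add.commute[of _ "_ :: 'a"])
  note [measurable] = prob_densD(3)[OF assms(1)] prob_densD(3)[OF assms(2)]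
  show "kernel_mixture.mix (density \<mu> v) (\<lambda>z. u (snd z + fst z)) = diff_dens u v"
    unfolding kernel_mixture.mix_def[OF km]
    using prob_densD(1)[OF assms(2)]
    by (intro ext, subst integral_real_density) (auto simp: diff_dens_swap)
qed

lemma diff_dens_measurable:
  assumes "prob_dens u" "prob_dens v" "finite_ent v"
  shows "diff_dens u v \<in> borel_measurable \<mu>"
  using kernel_mixture.mix_measurable[OF kernel_mixture_minus(1)[OF assms]]
  by (simp add: kernel_mixture_minus(3)[OF assms])

lemma nn_integral_diff_dens:
  assumes u: "prob_dens u" and v: "prob_dens v" "finite_ent v"
    and [measurable]: "h \<in> borel_measurable \<mu>"
  shows "(\<integral>\<^sup>+w. ennreal (diff_dens u v w) * h w \<partial>\<mu>) =
    (\<integral>\<^sup>+x. ennreal (u x) * (\<integral>\<^sup>+y. ennreal (v y) * h (x - y) \<partial>\<mu>) \<partial>\<mu>)"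
proof -
  interpret K: kernel_mixture "density \<mu> u" \<mu> "\<lambda>z. v (fst z - snd z)"
    by (rule kernel_mixture_minus(1)[OF u v])
  note mix = kernel_mixture_minus(3)[OF u v]
  note [measurable] = prob_densD(3)[OF u] prob_densD(3)[OF v(1)] diff_dens_measurable[OF u v]
  have [measurable_cong]: "sets (density \<mu> u) = sets \<mu>" by simp
  have "AE w in \<mu>. ennreal (diff_dens u v w) = (\<integral>\<^sup>+x. ennreal (v (x - w)) \<partial>density \<mu> u)"
    using K.AE_int(1) unfolding mix[symmetric] K.mix_def fst_conv snd_conv
    by eventually_elim (intro nn_integral_eq_integral[symmetric] AE_I2 prob_densD(1)[OF v(1)])
  then have "(\<integral>\<^sup>+w. ennreal (diff_dens u v w) * h w \<partial>\<mu>) =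
      (\<integral>\<^sup>+w. (\<integral>\<^sup>+x. ennreal (v (x - w)) \<partial>density \<mu> u) * h w \<partial>\<mu>)"
    by (intro nn_integral_cong_AE) (auto elim: eventually_mono)
  also have "\<dots> = (\<integral>\<^sup>+w. (\<integral>\<^sup>+x. ennreal (v (x - w)) * h w \<partial>density \<mu> u) \<partial>\<mu>)"
    by (intro nn_integral_cong nn_integral_multc[symmetric]) measurable
  also have "\<dots> = (\<integral>\<^sup>+x. (\<integral>\<^sup>+w. ennreal (v (x - w)) * h w \<partial>\<mu>) \<partial>density \<mu> u)"
    by (intro K.PQ.Fubini') measurable
  also have "\<dots> = (\<integral>\<^sup>+x. (\<integral>\<^sup>+y. ennreal (v y) * h (x - y) \<partial>\<mu>) \<partial>density \<mu> u)"
    using nn_integral_reflect[of "\<lambda>y. ennreal (v y) * h (x - y)" x for x] by simp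
  finally show ?thesis
    by (simp add: nn_integral_density)
qed

lemma prob_dens_diff_dens:
  assumes u: "prob_dens u" and v: "prob_dens v" "finite_ent v"
  shows "prob_dens (diff_dens u v)"
proof (rule prob_densI)
  show "0 \<le> diff_dens u v x" for x
    unfolding diff_dens_def using prob_densD(1)[OF u] prob_densD(1)[OF v(1)]
    by (intro Bochner_Integration.integral_nonneg) simp
  show "(\<integral>\<^sup>+w. ennreal (diff_dens u v w) \<partial>\<mu>) = 1"
    using nn_integral_diff_dens[OF u v, of "\<lambda>_. 1"] by (simp add: prob_densD(5) u v)
qed (rule diff_dens_measurable[OF u v])

lemma finite_ent_diff_dens:
  assumes u: "prob_dens u" and v: "prob_dens v" "finite_ent v"
  shows "finite_ent (diff_dens u v)"
  using kernel_mixture.xlnx_mix_integrable[OF kernel_mixture_minus(1)[OF u v]]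
  by (simp add: finite_ent_def kernel_mixture_minus(3)[OF u v])

text \<open>Mixing does not lower entropy, by Jensen, and the components are reflected translates of
  \<open>v\<close> or translates of \<open>u\<close>, according to the reading chosen.\<close>

lemma ent_le_diff_dens:
  assumes u: "prob_dens u" and v: "prob_dens v" "finite_ent v"
  shows "ent v \<le> ent (diff_dens u v)" and "finite_ent u \<Longrightarrow> ent u \<le> ent (diff_dens u v)"
proof -
  show "ent v \<le> ent (diff_dens u v)"
    using kernel_mixture.integral_xlnx_mix_le[OF kernel_mixture_minus(1)[OF u v]]
    by (simp add: kernel_mixture_minus(2,3)[OF u v] ent_def[of "diff_dens u v"])
  assume fu: "finite_ent u"
  show "ent u \<le> ent (diff_dens u v)"
    using kernel_mixture.integral_xlnx_mix_le[OF kernel_mixture_plus(1)[OF u v(1) fu]]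
    by (simp add: kernel_mixture_plus(2,3)[OF u v(1) fu] ent_def[of "diff_dens u v"])
qed

text \<open>For probability densities \<open>v\<close> of \<open>Y\<close> and \<open>k\<close>,
  this is the relative entropy of the law of \<open>x - Y\<close> with respect to the law with
  density \<open>k\<close>. The substitution \<open>w = x - y\<close> has been carried out, so that
  \<open>v\<close> appears untranslated.\<close>

definition kl_shift :: "('a \<Rightarrow> real) \<Rightarrow> ('a \<Rightarrow> real) \<Rightarrow> 'a \<Rightarrow> ennreal" where
  "kl_shift v k x = (\<integral>\<^sup>+y. kl_term (v y) (k (x - y)) \<partial>\<mu>)"

lemma kl_shift_measurable [measurable]:
  assumes [measurable]: "v \<in> borel_measurable \<mu>" "k \<in> borel_measurable \<mu>"
  shows "kl_shift v k \<in> borel_measurable \<mu>"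
  unfolding kl_shift_def by measurable

lemma nn_integral_kl_shift:
  assumes u: "prob_dens u" and v: "prob_dens v" "finite_ent v"
    and [measurable]: "k \<in> borel_measurable \<mu>" and k: "\<And>x. 0 \<le> k x"
  shows "(\<integral>\<^sup>+x. ennreal (u x) * kl_shift v k x \<partial>\<mu>) =
    ennreal (ent (diff_dens u v) - ent v) + (\<integral>\<^sup>+w. kl_term (diff_dens u v w) (k w) \<partial>\<mu>)"
proof -
  interpret K: kernel_mixture "density \<mu> u" \<mu> "\<lambda>z. v (fst z - snd z)"
    by (rule kernel_mixture_minus(1)[OF u v])
  note [measurable] = prob_densD(3)[OF u] prob_densD(3)[OF v(1)]
  have "kl_shift v k x = (\<integral>\<^sup>+w. kl_term (v (x - w)) (k w) \<partial>\<mu>)" for x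
    unfolding kl_shift_def
    using nn_integral_reflect[of "\<lambda>y. kl_term (v y) (k (x - y))" x] by simp
  then have "(\<integral>\<^sup>+x. ennreal (u x) * kl_shift v k x \<partial>\<mu>) =
      (\<integral>\<^sup>+x. (\<integral>\<^sup>+w. kl_term (v (x - w)) (k w) \<partial>\<mu>) \<partial>density \<mu> u)"
    by (simp add: nn_integral_density)
  moreover have "(\<integral>w. xlnx (diff_dens u v w) \<partial>\<mu>) = - ent (diff_dens u v)"
    by (simp add: ent_def)
  ultimately show ?thesis
    using K.compensation[of k] k
    by (simp add: kernel_mixture_minus(2,3)[OF u v])
qed

end

section \<open>Sublevel sets of the relative entropy to translates\<close>

text \<open>A pointwise form of Jensen's inequality for the exponential. With
  \<open>\<theta> = ln (b * c / a)\<close> the bracket equals \<open>a * (1 + \<theta> - v)\<close>,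
  and the tangent to \<open>exp\<close> at \<open>v\<close> bounds
  \<open>exp v * (1 + \<theta> - v)\<close> by \<open>exp \<theta>\<close>. The left side is linear
  in the relative entropy terms and can be integrated term by term.\<close>

lemma exp_tangent_kl_term:
  assumes "a \<ge> 0" "b \<ge> 0" "c \<ge> 0" "kl_term a b \<noteq> \<infinity>" "kl_term a c \<noteq> \<infinity>"
  shows "exp v * (xlnx a - enn2real (kl_term a b) - enn2real (kl_term a c) - a * (1 + v) + b + c) \<le> b * c"
proof (cases "a = 0")
  case True
  then show ?thesis using assms by (simp add: kl_term_def)
next
  case False
  then have pos: "a > 0" "b > 0" "c > 0"
    using assms by (auto simp: kl_term_def less_le)
  define \<theta> where "\<theta> = ln (b * c / a)"
  have "xlnx a - enn2real (kl_term a b) - enn2real (kl_term a c) - a * (1 + v) + b + c = a * (1 + (\<theta> - v))"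
    using pos xlnx_tangent[of a b] xlnx_tangent[of a c]
    by (simp add: kl_term_pos \<theta>_def ln_div ln_mult xlnx_def algebra_simps)
  also have "\<dots> \<le> a * exp (\<theta> - v)"
    using exp_ge_add_one_self[of "\<theta> - v"] pos by (intro mult_left_mono) auto
  finally have "exp v * (xlnx a - enn2real (kl_term a b) - enn2real (kl_term a c) - a * (1 + v) + b + c)
      \<le> exp v * (a * exp (\<theta> - v))"
    by (intro mult_left_mono) auto
  also have "\<dots> = a * exp \<theta>" by (simp add: exp_diff)
  also have "\<dots> = b * c" using pos by (simp add: \<theta>_def)
  finally show ?thesis .
qed

definition unif_dens :: "'a measure \<Rightarrow> 'a set \<Rightarrow> 'a \<Rightarrow> real" where
  "unif_dens \<mu> S x = indicator S x / measure \<mu> S"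

context haar_group
begin

lemma unif_dens:
  assumes [measurable]: "S \<in> sets \<mu>" and pos: "measure \<mu> S > 0"
  shows "prob_dens (unif_dens \<mu> S)" "finite_ent (unif_dens \<mu> S)" "ent (unif_dens \<mu> S) = ln (measure \<mu> S)"
proof -
  have L: "xlnx (unif_dens \<mu> S x) = - ln (measure \<mu> S) / measure \<mu> S * indicator S x" for x
    using pos by (auto simp: unif_dens_def xlnx_def ln_div split: split_indicator)
  show "prob_dens (unif_dens \<mu> S)"
    using pos unfolding prob_dens_def unif_dens_def[abs_def]
    by (auto simp: less_top[symmetric])
  show "finite_ent (unif_dens \<mu> S)"
    unfolding finite_ent_def L by (simp add: less_top[symmetric])
  show "ent (unif_dens \<mu> S) = ln (measure \<mu> S)"
    unfolding ent_def L using pos by simp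
qed

end

locale two_densities = haar_group \<mu> for \<mu> :: "'a::ab_group_add measure" +
  fixes f g :: "'a \<Rightarrow> real"
  assumes f: "prob_dens f" "finite_ent f" and g: "prob_dens g" "finite_ent g"
begin

abbreviation "k \<equiv> diff_dens f g"
abbreviation "D \<equiv> kl_shift g k"

lemmas k = prob_dens_diff_dens[OF f(1) g]

lemmas [measurable] = prob_densD(3)[OF f(1)] prob_densD(3)[OF g(1)] prob_densD(3)[OF k]

lemma ent_ge_f: "ent f \<le> ent k" and ent_ge_g: "ent g \<le> ent k"
  using ent_le_diff_dens[OF f(1) g] f(2) by auto

lemma nn_integral_f_D: "(\<integral>\<^sup>+x. ennreal (f x) * D x \<partial>\<mu>) = ennreal (ent k - ent g)"
  using nn_integral_kl_shift[OF f(1) g _ prob_densD(1)[OF k]] prob_densD(1)[OF k]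
  by (simp add: kl_term_self)

text \<open>In \<open>nn_integral_kl_shift\<close> with reference \<open>k\<close>, the relative
  entropy of the new mixture to \<open>k\<close> is nonnegative and may be dropped.\<close>

lemma ent_diff_dens_le:
  assumes u: "prob_dens u" and le: "(\<integral>\<^sup>+x. ennreal (u x) * D x \<partial>\<mu>) \<le> ennreal c" and "c \<ge> 0"
  shows "ent (diff_dens u g) \<le> ent g + c"
proof -
  have "ennreal (ent (diff_dens u g) - ent g) \<le> (\<integral>\<^sup>+x. ennreal (u x) * D x \<partial>\<mu>)"
    using nn_integral_kl_shift[OF u g _ prob_densD(1)[OF k]] by simp
  also note le
  finally show ?thesis using \<open>c \<ge> 0\<close> by (simp add: ennreal_le_iff)
qed

lemma ent_unif_diff_le:
  assumes T [measurable]: "T \<in> sets \<mu>" "measure \<mu> T > 0" and D: "\<And>x. x \<in> T \<Longrightarrow> D x \<le> ennreal t" and "t \<ge> 0"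
  shows "ent (diff_dens (unif_dens \<mu> T) g) \<le> ent g + t"
proof (rule ent_diff_dens_le[OF unif_dens(1)[OF T] _ \<open>t \<ge> 0\<close>])
  have "(\<integral>\<^sup>+x. ennreal (unif_dens \<mu> T x) * D x \<partial>\<mu>) \<le> (\<integral>\<^sup>+x. ennreal (unif_dens \<mu> T x) * ennreal t \<partial>\<mu>)"
    using D by (intro nn_integral_mono) (auto simp: unif_dens_def intro!: mult_left_mono split: split_indicator)
  also have "\<dots> = ennreal t"
    using prob_densD(3,5)[OF unif_dens(1)[OF T]] by (subst nn_integral_multc) auto
  finally show "(\<integral>\<^sup>+x. ennreal (unif_dens \<mu> T x) * D x \<partial>\<mu>) \<le> ennreal t" .
qed

text \<open>Split the integral of \<open>xlnx (f x)\<close> along \<open>T\<close>. On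
  \<open>T\<close>, Jensen gives at least \<open>p * ln (p / m)\<close>. Off \<open>T\<close>, the
  conditional law has entropy at most that of its difference with \<open>Y\<close>, which is at most
  \<open>ent g + (ent k - ent g) / q\<close>.\<close>

lemma measure_lower_bound:
  assumes T [measurable]: "T \<in> sets \<mu>" and p_def: "p = (\<integral>x. f x * indicator T x \<partial>\<mu>)" and "p > 0"
  shows "p * (ent g - ln (measure \<mu> T)) \<le> ent k - ent f + binary_entropy p" and "measure \<mu> T > 0"
proof -
  define m where "m = measure \<mu> T"
  show m: "measure \<mu> T > 0"
  proof (rule ccontr)
    assume "\<not> measure \<mu> T > 0"
    then have "measure \<mu> T = 0" using measure_nonneg[of \<mu> T] by linarith
    then have "T \<in> null_sets \<mu>" by (simp add: null_sets_def emeasure_eq_measure)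
    then have "AE x in \<mu>. x \<notin> T" by (rule AE_not_in)
    then have "p = (\<integral>x. 0 \<partial>\<mu>)"
      unfolding p_def by (intro integral_cong_AE) (auto elim: eventually_mono)
    then show False using \<open>p > 0\<close> by simp
  qed
  note fi = prob_densD(2)[OF f(1)] and f0 = prob_densD(1)[OF f(1)]
  have Lf: "integrable \<mu> (\<lambda>x. xlnx (f x))" using f(2) by (simp add: finite_ent_def)
  have int: "integrable \<mu> (\<lambda>x. f x * indicator A x)" "integrable \<mu> (\<lambda>x. xlnx (f x) * indicator A x)"
    if "A \<in> sets \<mu>" for A
    using fi Lf that by (auto intro: integrable_real_mult_indicator)
  have compl: "- T \<in> sets \<mu>" using sets.compl_sets[OF T] by (simp add: Compl_eq_Diff_UNIV)
  define q where "q = 1 - p"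
  have split: "(\<integral>x. h x \<partial>\<mu>) = (\<integral>x. h x * indicator T x \<partial>\<mu>) + (\<integral>x. h x * indicator (- T) x \<partial>\<mu>)"
    if "integrable \<mu> (\<lambda>x. h x * indicator T x)" "integrable \<mu> (\<lambda>x. h x * indicator (- T) x)" for h :: "'a \<Rightarrow> real"
  proof -
    have "h x = h x * indicator T x + h x * indicator (- T) x" for x
      by (simp split: split_indicator)
    then show ?thesis
      using Bochner_Integration.integral_add[OF that] by simp
  qed
  have q: "(\<integral>x. f x * indicator (- T) x \<partial>\<mu>) = q"
    using split[OF int(1)[OF T] int(1)[OF compl]] prob_densD(4)[OF f(1)] by (simp add: q_def p_def)
  have "q \<ge> 0" unfolding q[symmetric] using f0 by (intro Bochner_Integration.integral_nonneg) auto
  have inT: "p * ln p - p * ln m \<le> (\<integral>x. xlnx (f x) * indicator T x \<partial>\<mu>)"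
  proof -
    \<comment> \<open>The tangent is taken at \<open>p / m\<close>, the average of \<open>f\<close>
      over \<open>T\<close>, so that the terms without logarithm cancel.\<close>
    have "0 \<le> (\<integral>x. (xlnx (f x) - f x * ln (p / m) - f x + p / m) * indicator T x \<partial>\<mu>)"
      using f0 m \<open>p > 0\<close> by (intro Bochner_Integration.integral_nonneg mult_nonneg_nonneg xlnx_tangent) (auto simp: m_def)
    also have "\<dots> = (\<integral>x. xlnx (f x) * indicator T x - ln (p / m) * (f x * indicator T x)
          - f x * indicator T x + p / m * indicator T x \<partial>\<mu>)"
      by (intro Bochner_Integration.integral_cong) (auto simp: algebra_simps)
    also have "\<dots> = (\<integral>x. xlnx (f x) * indicator T x \<partial>\<mu>) - ln (p / m) * p - p + p / m * m"
      using int[OF T] by (simp add: p_def m_def less_top[symmetric])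
    finally show ?thesis using m \<open>p > 0\<close> by (simp add: m_def ln_div algebra_simps)
  qed
  have outT: "q * ln q - q * ent g - (ent k - ent g) \<le> (\<integral>x. xlnx (f x) * indicator (- T) x \<partial>\<mu>)"
  proof (cases "q = 0")
    case True
    then have "AE x in \<mu>. f x * indicator (- T) x = 0"
      using integral_nonneg_eq_0_iff_AE[OF int(1)[OF compl]] q f0 by simp
    then have "(\<integral>x. xlnx (f x) * indicator (- T) x \<partial>\<mu>) = (\<integral>x. 0 \<partial>\<mu>)"
      using compl by (intro integral_cong_AE) (auto elim: eventually_mono split: split_indicator)
    then show ?thesis using True ent_ge_g by simp
  next
    case False
    then have q0: "q > 0" using \<open>q \<ge> 0\<close> by simp
    define u where "u x = f x * indicator (- T) x / q" for x
    have u: "prob_dens u"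
      using int(1)[OF compl] q q0 f0 unfolding u_def prob_dens_def by auto
    have Lu: "xlnx (u x) = (xlnx (f x) * indicator (- T) x - ln q * (f x * indicator (- T) x)) / q" for x
      using q0 f0[of x] by (cases "f x = 0") (auto simp: u_def xlnx_def ln_div field_simps split: split_indicator)
    have fu: "finite_ent u"
      unfolding finite_ent_def Lu using int[OF compl] by auto
    have "ent u = - ((\<integral>x. xlnx (f x) * indicator (- T) x \<partial>\<mu>) - ln q * q) / q"
      unfolding ent_def Lu using int[OF compl] by (simp add: q minus_divide_left)
    moreover have "ent u \<le> ent (diff_dens u g)"
      using ent_le_diff_dens(2)[OF u g fu] .
    moreover have "ent (diff_dens u g) \<le> ent g + (ent k - ent g) / q"
    proof (rule ent_diff_dens_le[OF u])
      \<comment> \<open>Since \<open>u\<close> is at most \<open>f / q\<close> pointwise, its mean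
        of \<open>D\<close> is at most \<open>1 / q\<close> times that of \<open>f\<close>.\<close>
      have "(\<integral>\<^sup>+x. ennreal (u x) * D x \<partial>\<mu>) \<le> (\<integral>\<^sup>+x. ennreal (1 / q) * (ennreal (f x) * D x) \<partial>\<mu>)"
        using q0 f0 by (intro nn_integral_mono)
          (auto simp: u_def ennreal_mult[symmetric] mult.assoc[symmetric] split: split_indicator)
      also have "\<dots> = ennreal (1 / q) * ennreal (ent k - ent g)"
        by (subst nn_integral_cmult) (auto simp: nn_integral_f_D)
      also have "\<dots> = ennreal ((ent k - ent g) / q)"
        using q0 ent_ge_g by (subst ennreal_mult[symmetric]) auto
      finally show "(\<integral>\<^sup>+x. ennreal (u x) * D x \<partial>\<mu>) \<le> ennreal ((ent k - ent g) / q)" .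
    qed (use q0 ent_ge_g in auto)
    ultimately have "- ((\<integral>x. xlnx (f x) * indicator (- T) x \<partial>\<mu>) - ln q * q) / q \<le> ent g + (ent k - ent g) / q"
      by linarith
    also have "\<dots> = (q * ent g + (ent k - ent g)) / q"
      using q0 by (simp add: add_divide_distrib)
    finally show ?thesis using q0 by (simp add: divide_le_cancel algebra_simps)
  qed
  have "- ent f = (\<integral>x. xlnx (f x) * indicator T x \<partial>\<mu>) + (\<integral>x. xlnx (f x) * indicator (- T) x \<partial>\<mu>)"
    using split[OF int(2)[OF T] int(2)[OF compl]] by (simp add: ent_def)
  then show "p * (ent g - ln (measure \<mu> T)) \<le> ent k - ent f + binary_entropy p"
    using inT outT by (simp add: binary_entropy_def q_def m_def algebra_simps)
qed

text \<open>\<open>R\<close> is the density of the difference of two independent copies of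
  \<open>X - Y\<close>, so it has integral 1. A lower bound \<open>exp v\<close> for
  \<open>R\<close> on \<open>self_diff T\<close> therefore bounds the measure of that set by
  \<open>exp (- v)\<close>.\<close>

lemma self_diff_upper_bound:
  assumes T: "\<And>x. x \<in> T \<Longrightarrow> D x \<le> ennreal t" and "t \<ge> 0" and [measurable]: "self_diff T \<in> sets \<mu>"
  shows "measure \<mu> (self_diff T) \<le> exp (2 * t + ent g)"
proof -
  \<comment> \<open>For \<open>s1\<close>, \<open>s2\<close> in \<open>T\<close>, the mean under
    \<open>g\<close> of \<open>ln (k (s1 - y) * k (s2 - y) / g y)\<close> is
    \<open>- ent g - D s1 - D s2\<close>, which is at least this number.\<close>
  define v where "v = - ent g - 2 * t"
  define R where "R z = (\<integral>\<^sup>+w. ennreal (k (z + w)) * ennreal (k w) \<partial>\<mu>)" for z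
  have k0: "0 \<le> k x" for x by (rule prob_densD(1)[OF k])
  have R_ge: "ennreal (exp v) \<le> R z" if "z \<in> self_diff T" for z
  proof -
    from that obtain s1 s2 where s: "s1 \<in> T" "s2 \<in> T" "z = s1 - s2"
      by (auto simp: self_diff_def)
    \<comment> \<open>\<open>enn2real\<close> turns the value infinity into 0, but for
      \<open>s\<close> in \<open>T\<close> that value occurs only on a null set of
      \<open>y\<close>.\<close>
    define r where "r s y = enn2real (kl_term (g y) (k (s - y)))" for s y
    have r0: "0 \<le> r s y" for s y
      by (simp add: r_def)
    have r: "AE y in \<mu>. kl_term (g y) (k (s - y)) \<noteq> \<infinity>" "integrable \<mu> (r s)" "(\<integral>y. r s y \<partial>\<mu>) \<le> t"
      if "s \<in> T" for s
    proof -
      have le: "(\<integral>\<^sup>+y. kl_term (g y) (k (s - y)) \<partial>\<mu>) \<le> ennreal t"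
        using T[OF that] by (simp add: kl_shift_def)
      then show AE: "AE y in \<mu>. kl_term (g y) (k (s - y)) \<noteq> \<infinity>"
        by (intro nn_integral_PInf_AE) (auto simp: top_unique)
      then have "AE y in \<mu>. ennreal (r s y) = kl_term (g y) (k (s - y))"
        unfolding r_def by eventually_elim (simp add: less_top[symmetric])
      then have eq: "(\<integral>\<^sup>+y. ennreal (r s y) \<partial>\<mu>) = (\<integral>\<^sup>+y. kl_term (g y) (k (s - y)) \<partial>\<mu>)"
        by (rule nn_integral_cong_AE)
      show "integrable \<mu> (r s)"
      proof (rule integrableI_nonneg)
        show "r s \<in> borel_measurable \<mu>" unfolding r_def by measurable
        show "(\<integral>\<^sup>+y. ennreal (r s y) \<partial>\<mu>) < \<infinity>" unfolding eq using le by (simp add: le_less_trans)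
      qed (simp add: r_def)
      then have "ennreal (\<integral>y. r s y \<partial>\<mu>) = (\<integral>\<^sup>+y. kl_term (g y) (k (s - y)) \<partial>\<mu>)"
        unfolding eq[symmetric] using r0 by (intro nn_integral_eq_integral[symmetric]) auto
      then have "ennreal (\<integral>y. r s y \<partial>\<mu>) \<le> ennreal t"
        using le by simp
      then show "(\<integral>y. r s y \<partial>\<mu>) \<le> t"
        using \<open>t \<ge> 0\<close> by (simp add: ennreal_le_iff)
    qed
    have kr: "integrable \<mu> (\<lambda>y. k (s - y))" "(\<integral>y. k (s - y) \<partial>\<mu>) = 1" for s
      using integrable_reflect[OF prob_densD(2)[OF k]] prob_densD(4)[OF k] by (auto simp: integral_reflect)
    have R_eq: "R z = (\<integral>\<^sup>+y. ennreal (k (s1 - y) * k (s2 - y)) \<partial>\<mu>)"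
      unfolding R_def
      by (subst nn_integral_reflect[of _ s2, symmetric])
        (auto simp: s(3) ennreal_mult k0 algebra_simps)
    show ?thesis
    proof (cases "R z = \<infinity>")
      case False
      \<comment> \<open>This is the left side of \<open>exp_tangent_kl_term\<close>. As
        \<open>g\<close> and the two translates of \<open>k\<close> have integral 1, its integral is
        at least \<open>exp v\<close> by the choice of \<open>v\<close>.\<close>
      define h where "h y = exp v * (xlnx (g y) - r s1 y - r s2 y - g y * (1 + v) + k (s1 - y) + k (s2 - y))" for y
      have Lg: "integrable \<mu> (\<lambda>y. xlnx (g y))" using g(2) by (simp add: finite_ent_def)
      have int_kk: "integrable \<mu> (\<lambda>y. k (s1 - y) * k (s2 - y))"
        using False k0 by (intro integrableI_nonneg) (auto simp: R_eq less_top[symmetric])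
      have int_h: "integrable \<mu> h"
        unfolding h_def using Lg r(2)[OF s(1)] r(2)[OF s(2)] kr prob_densD(2)[OF g(1)] by simp
      have "exp v \<le> exp v * (- ent g - (\<integral>y. r s1 y \<partial>\<mu>) - (\<integral>y. r s2 y \<partial>\<mu>) - (1 + v) + 1 + 1)"
        using r(3)[OF s(1)] r(3)[OF s(2)] by (simp add: v_def)
      also have "\<dots> = (\<integral>y. h y \<partial>\<mu>)"
        unfolding h_def using Lg r(2)[OF s(1)] r(2)[OF s(2)] kr prob_densD(2,4)[OF g(1)] by (simp add: ent_def)
      also have "\<dots> \<le> (\<integral>y. k (s1 - y) * k (s2 - y) \<partial>\<mu>)"
      proof (rule integral_mono_AE[OF int_h int_kk])
        show "AE y in \<mu>. h y \<le> k (s1 - y) * k (s2 - y)"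
          using r(1)[OF s(1)] r(1)[OF s(2)] unfolding h_def r_def
          by eventually_elim (intro exp_tangent_kl_term k0 prob_densD(1)[OF g(1)])
      qed
      finally have "ennreal (exp v) \<le> ennreal (\<integral>y. k (s1 - y) * k (s2 - y) \<partial>\<mu>)"
        by (rule ennreal_leI)
      also have "\<dots> = R z"
        unfolding R_eq using int_kk k0 by (intro nn_integral_eq_integral[symmetric]) auto
      finally show ?thesis .
    qed simp
  qed
  have "(\<integral>\<^sup>+z. R z \<partial>\<mu>) = (\<integral>\<^sup>+w. (\<integral>\<^sup>+z. ennreal (k (z + w)) * ennreal (k w) \<partial>\<mu>) \<partial>\<mu>)"
    unfolding R_def by (rule pair.Fubini') measurable
  also have "\<dots> = (\<integral>\<^sup>+w. (\<integral>\<^sup>+z. ennreal (k (w + z)) \<partial>\<mu>) * ennreal (k w) \<partial>\<mu>)"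
    by (intro nn_integral_cong) (subst nn_integral_multc[symmetric], auto simp: add.commute)
  also have "\<dots> = 1"
    using nn_integral_shift[of "\<lambda>x. ennreal (k x)"] prob_densD(5)[OF k] by simp
  finally have R1: "(\<integral>\<^sup>+z. R z \<partial>\<mu>) = 1" .
  have "ennreal (exp v) * emeasure \<mu> (self_diff T) = (\<integral>\<^sup>+z. ennreal (exp v) * indicator (self_diff T) z \<partial>\<mu>)"
    by (simp add: nn_integral_cmult_indicator)
  also have "\<dots> \<le> (\<integral>\<^sup>+z. R z \<partial>\<mu>)"
    using R_ge by (intro nn_integral_mono) (auto split: split_indicator)
  finally have "ennreal (exp v * measure \<mu> (self_diff T)) \<le> ennreal 1"
    by (simp add: R1 emeasure_eq_measure ennreal_mult)
  then have "exp v * measure \<mu> (self_diff T) \<le> 1" by (subst (asm) ennreal_le_iff) auto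
  then have "measure \<mu> (self_diff T) \<le> exp (- v)" by (simp add: exp_minus field_simps)
  then show ?thesis by (simp add: v_def add.commute)
qed

lemma D_eq_0_iff: "D x = 0 \<longleftrightarrow> (AE y in \<mu>. g y = k (x - y))"
proof
  assume "D x = 0"
  then have "AE y in \<mu>. kl_term (g y) (k (x - y)) = 0"
    by (simp add: kl_shift_def nn_integral_0_iff_AE)
  then show "AE y in \<mu>. g y = k (x - y)"
    by eventually_elim (intro kl_term_eq_0 prob_densD(1)[OF g(1)] prob_densD(1)[OF k])
next
  assume "AE y in \<mu>. g y = k (x - y)"
  then have "AE y in \<mu>. kl_term (g y) (k (x - y)) = 0"
    by eventually_elim (simp add: kl_term_self prob_densD(1)[OF k])
  then show "D x = 0"
    by (simp add: kl_shift_def nn_integral_0_iff_AE)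
qed

text \<open>Almost everywhere, \<open>k (x - y + z - w) = g (y - z + w) = k (z - w) = g w\<close>:
  the first two equalities are the hypotheses on \<open>x\<close> and \<open>y\<close> at the
  translated point \<open>y - z + w\<close>, the last is the one on \<open>z\<close>.\<close>

lemma D_eq_0_coset:
  assumes "D x = 0" "D y = 0" "D z = 0"
  shows "D (x - y + z) = 0"
proof -
  have shiftAE: "AE w in \<mu>. P (y - z + w)" if "AE w in \<mu>. P w" for P
    using that by (subst (asm) distr_shift[of "y - z", symmetric]) (auto dest: AE_distrD[rotated])
  have "AE w in \<mu>. g w = k (z - w)" "AE w in \<mu>. g (y - z + w) = k (y - (y - z + w))"
    "AE w in \<mu>. g (y - z + w) = k (x - (y - z + w))"
    using assms shiftAE[of "\<lambda>w. g w = k (y - w)"] shiftAE[of "\<lambda>w. g w = k (x - w)"] by (simp_all add: D_eq_0_iff)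
  then have "AE w in \<mu>. g w = k (x - y + z - w)"
    by eventually_elim (simp add: algebra_simps)
  then show ?thesis by (simp add: D_eq_0_iff)
qed

end

section \<open>Entropy of random variables and the choice of the set\<close>

context haar_group
begin

lemma density_entropy_prob_dens:
  assumes u: "prob_dens u"
  shows "density_entropy \<mu> u = (if finite_ent u then ereal (ent u) else - \<infinity>)"
proof -
  note [measurable] = prob_densD(3)[OF u]
  define P where "P = (\<integral>\<^sup>+x. ennreal (- xlnx (u x)) \<partial>\<mu>)"
  define N where "N = (\<integral>\<^sup>+x. ennreal (xlnx (u x)) \<partial>\<mu>)"
  have "P \<le> (\<integral>\<^sup>+x. ennreal 1 \<partial>\<mu>)"
    unfolding P_def using xlnx_ge[OF prob_densD(1)[OF u]]
    by (intro nn_integral_mono ennreal_leI) (simp add: minus_le_iff)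
  then have P: "P < \<infinity>" by (simp add: le_less_trans emeasure_space_1[simplified])
  have eq: "density_entropy \<mu> u = enn2ereal P - enn2ereal N"
    unfolding density_entropy_def P_def N_def xlnx_def by simp
  show ?thesis
  proof (cases "N = \<infinity>")
    case True
    then have "\<not> finite_ent u"
      unfolding finite_ent_def real_integrable_def N_def by simp
    moreover have "enn2ereal P - enn2ereal N = - \<infinity>"
      using P True by (cases P) auto
    ultimately show ?thesis by (simp add: eq)
  next
    case False
    have L: "finite_ent u"
      using P False unfolding finite_ent_def real_integrable_def P_def N_def by auto
    have "ent u = enn2real P - enn2real N"
      using L unfolding ent_def finite_ent_def P_def N_def by (simp add: real_lebesgue_integral_def)
    moreover have "enn2ereal P - enn2ereal N = ereal (enn2real P - enn2real N)"
      using P False by (cases P; cases N) auto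
    ultimately show ?thesis using L by (simp add: eq)
  qed
qed

lemma rv_entropy_density:
  assumes "X \<in> M \<rightarrow>\<^sub>M \<mu>" and u: "prob_dens u" and eq: "distr M \<mu> X = density \<mu> u"
  shows "rv_entropy \<mu> M X = (if finite_ent u then ereal (ent u) else - \<infinity>)"
proof -
  note [measurable] = prob_densD(3)[OF u]
  have "distributed M \<mu> X (\<lambda>x. ennreal (u x))"
    using assms by (simp add: distributed_def)
  then have ex: "\<exists>f. distributed M \<mu> X f" by blast
  have "AE x in \<mu>. ennreal (u x) = RN_deriv \<mu> (distr M \<mu> X) x"
    by (rule RN_deriv_unique[OF _ eq[symmetric]]) measurable
  then have AE: "AE x in \<mu>. enn2real (RN_deriv \<mu> (distr M \<mu> X) x) = u x"
    by eventually_elim (metis enn2real_ennreal prob_densD(1)[OF u])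
  have "density_entropy \<mu> (\<lambda>x. enn2real (RN_deriv \<mu> (distr M \<mu> X) x)) = density_entropy \<mu> u"
    unfolding density_entropy_def using AE
    by (intro arg_cong2[of _ _ _ _ minus] arg_cong[of _ _ enn2ereal] nn_integral_cong_AE)
      (auto elim: eventually_mono)
  then show ?thesis
    using ex by (simp add: rv_entropy_def density_entropy_prob_dens[OF u])
qed

lemma finite_rv_entropyE:
  assumes "prob_space M" and X: "X \<in> M \<rightarrow>\<^sub>M \<mu>" and fin: "rv_entropy \<mu> M X > - \<infinity>"
  obtains u where "prob_dens u" "finite_ent u" "distr M \<mu> X = density \<mu> u"
proof -
  interpret M: prob_space M by fact
  obtain v where "distributed M \<mu> X v"
    using fin by (auto simp: rv_entropy_def split: if_splits)
  then have v: "distr M \<mu> X = density \<mu> v" and [measurable]: "v \<in> borel_measurable \<mu>"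
    by (auto simp: distributed_def)
  have "emeasure (distr M \<mu> X) UNIV = 1"
    using X M.emeasure_space_1 sets.top[of \<mu>] by (simp add: emeasure_distr measurable_space)
  then have v1: "(\<integral>\<^sup>+x. v x \<partial>\<mu>) = 1"
    unfolding v using emeasure_density[of v \<mu> UNIV] sets.top[of \<mu>] by simp
  then have "AE x in \<mu>. v x \<noteq> \<infinity>"
    by (intro nn_integral_PInf_AE) auto
  then have AE: "AE x in \<mu>. ennreal (enn2real (v x)) = v x"
    by eventually_elim (simp add: less_top[symmetric])
  have u: "prob_dens (\<lambda>x. enn2real (v x))"
    using nn_integral_cong_AE[OF AE] v1 by (intro prob_densI) auto
  moreover have eq: "distr M \<mu> X = density \<mu> (\<lambda>x. enn2real (v x))"
    unfolding v using AE by (intro density_cong) (auto elim: eventually_mono)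
  moreover have "finite_ent (\<lambda>x. enn2real (v x))"
    using fin rv_entropy_density[OF X u eq] by (auto split: if_splits)
  ultimately show ?thesis using that by blast
qed

lemma ruzsa_dist_density:
  assumes "prob_space M" "prob_space N"
    and X: "X \<in> M \<rightarrow>\<^sub>M \<mu>" and u: "prob_dens u" "finite_ent u" and Xu: "distr M \<mu> X = density \<mu> u"
    and Y: "Y \<in> N \<rightarrow>\<^sub>M \<mu>" and v: "prob_dens v" "finite_ent v" and Yv: "distr N \<mu> Y = density \<mu> v"
  shows "ruzsa_dist \<mu> M X N Y = ereal (ent (diff_dens u v) - ent u / 2 - ent v / 2)"
proof -
  note [measurable] = prob_densD(3)[OF u(1)] prob_densD(3)[OF v(1)]
    diff_dens_measurable[OF u(1) v]
  interpret U: prob_space "density \<mu> u" by (rule prob_densD[OF u(1)])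
  interpret V: prob_space "density \<mu> v" by (rule prob_densD[OF v(1)])
  interpret UV: pair_sigma_finite "density \<mu> u" "density \<mu> v" ..
  have [measurable_cong]: "sets (density \<mu> u) = sets \<mu>" "sets (density \<mu> v) = sets \<mu>" by simp_all
  have meas [measurable]: "(\<lambda>(x, y). x - y) \<in> density \<mu> u \<Otimes>\<^sub>M density \<mu> v \<rightarrow>\<^sub>M \<mu>"
    unfolding case_prod_beta' by measurable
  have "distr (density \<mu> u \<Otimes>\<^sub>M density \<mu> v) \<mu> (\<lambda>(x, y). x - y) = density \<mu> (diff_dens u v)"
  proof (rule measure_eqI)
    fix A assume "A \<in> sets (distr (density \<mu> u \<Otimes>\<^sub>M density \<mu> v) \<mu> (\<lambda>(x, y). x - y))"
    then have A [measurable]: "A \<in> sets \<mu>" by simp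
    have "emeasure (distr (density \<mu> u \<Otimes>\<^sub>M density \<mu> v) \<mu> (\<lambda>(x, y). x - y)) A
        = (\<integral>\<^sup>+z. indicator A ((\<lambda>(x, y). x - y) z) \<partial>(density \<mu> u \<Otimes>\<^sub>M density \<mu> v))"
      by (subst nn_integral_distr[symmetric, of _ _ \<mu>]) auto
    also have "\<dots> = (\<integral>\<^sup>+x. (\<integral>\<^sup>+y. indicator A (x - y) \<partial>density \<mu> v) \<partial>density \<mu> u)"
      by (subst V.nn_integral_fst[symmetric]) (auto simp: case_prod_beta')
    also have "\<dots> = (\<integral>\<^sup>+x. ennreal (u x) * (\<integral>\<^sup>+y. ennreal (v y) * indicator A (x - y) \<partial>\<mu>) \<partial>\<mu>)"
      by (simp add: nn_integral_density)
    also have "\<dots> = (\<integral>\<^sup>+w. ennreal (diff_dens u v w) * indicator A w \<partial>\<mu>)"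
      by (rule nn_integral_diff_dens[OF u(1) v, symmetric]) measurable
    finally show "emeasure (distr (density \<mu> u \<Otimes>\<^sub>M density \<mu> v) \<mu> (\<lambda>(x, y). x - y)) A =
        emeasure (density \<mu> (diff_dens u v)) A"
      by (simp add: emeasure_density)
  qed simp
  then show ?thesis
    unfolding ruzsa_dist_def Xu Yv
    using rv_entropy_density[OF meas prob_dens_diff_dens[OF u(1) v]] finite_ent_diff_dens[OF u(1) v]
      rv_entropy_density[OF X u(1) Xu] rv_entropy_density[OF Y v(1) Yv] u(2) v(2)
    by simp
qed

end

section \<open>Binary entropy and the estimates for a sublevel set\<close>

lemma binary_entropy_nonneg:
  assumes "0 \<le> p" "p \<le> 1"
  shows "0 \<le> binary_entropy p"
proof -
  have "a * ln a \<le> 0" if "0 \<le> a" "a \<le> 1" for a :: real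
    using that by (cases "a = 0") (auto simp: mult_nonneg_nonpos)
  from this[of p] this[of "1 - p"] show ?thesis
    using assms by (simp add: binary_entropy_def)
qed

text \<open>The cross entropy \<open>- p ln r - (1 - p) ln (1 - r)\<close> lies above \<^term>\<open>binary_entropy p\<close>,
  is affine and decreasing in \<open>p\<close>, and equals \<^term>\<open>binary_entropy r\<close> at \<open>p = r\<close>.\<close>

lemma binary_entropy_antimono:
  assumes "1 / 2 \<le> r" "r \<le> p" "p \<le> 1" "r < 1"
  shows "binary_entropy p \<le> binary_entropy r"
proof -
  have "binary_entropy p \<le> - p * ln r - (1 - p) * ln (1 - r)"
    using xlnx_tangent[of p r] xlnx_tangent[of "1 - p" "1 - r"] assms
    by (simp add: binary_entropy_def xlnx_def)
  moreover have "0 \<le> (p - r) * (ln r - ln (1 - r))"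
    using assms by (intro mult_nonneg_nonneg) auto
  ultimately show ?thesis
    by (simp add: binary_entropy_def algebra_simps)
qed

context two_densities
begin

definition ruzsa_d :: real where
  "ruzsa_d = ent k - ent f / 2 - ent g / 2"

lemma ruzsa_d: "ent k - ent g \<le> 2 * ruzsa_d" "ent k - ent f \<le> 2 * ruzsa_d" "0 \<le> ruzsa_d"
  using ent_ge_f ent_ge_g by (simp_all add: ruzsa_d_def)

text \<open>Both bounds reduce to the gap \<open>ent g - ln (measure \<mu> T)\<close>: the distance
  is at most \<open>t\<close> plus half the gap, the logarithm of the doubling ratio at most
  \<open>2 * t\<close> plus the gap. \<open>measure_lower_bound\<close> controls the gap, and
  \<open>p \<ge> 1 / 2\<close> costs a factor 2.\<close>

lemma level_subset_bounds:
  assumes T [measurable]: "T \<in> sets \<mu>" "self_diff T \<in> sets \<mu>"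
    and D: "\<And>x. x \<in> T \<Longrightarrow> D x \<le> ennreal t" and t: "t \<ge> 0"
    and p_def: "p = (\<integral>x. f x * indicator T x \<partial>\<mu>)" and p: "p \<ge> 1 / 2" "p \<le> 1"
  shows "measure \<mu> T > 0"
    and "ent (diff_dens (unif_dens \<mu> T) g) - ln (measure \<mu> T) / 2 - ent g / 2
      \<le> t + 2 * ruzsa_d + binary_entropy p"
    and "ln (measure \<mu> (self_diff T) / measure \<mu> T) \<le> 2 * (t + 2 * ruzsa_d + binary_entropy p)"
proof -
  have p0: "p > 0" using p by simp
  note lower = measure_lower_bound[OF T(1) p_def p0]
  show pos: "measure \<mu> T > 0" by (rule lower(2))
  define r where "r = 2 * ruzsa_d + binary_entropy p"
  have r: "r \<ge> 0" using ruzsa_d(3) binary_entropy_nonneg p by (simp add: r_def)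
  have gap: "ent g - ln (measure \<mu> T) \<le> 2 * r"
  \<comment> \<open>Replacing \<open>p\<close> by \<open>1 / 2\<close> needs a nonnegative gap; a
    negative one is below \<open>2 * r\<close> anyway.\<close>
  proof (cases "ent g - ln (measure \<mu> T) \<ge> 0")
    case True
    then have "1 / 2 * (ent g - ln (measure \<mu> T)) \<le> p * (ent g - ln (measure \<mu> T))"
      using p by (intro mult_right_mono) auto
    then show ?thesis using lower(1) ruzsa_d(2) by (simp add: r_def)
  qed (use r in auto)
  show "ent (diff_dens (unif_dens \<mu> T) g) - ln (measure \<mu> T) / 2 - ent g / 2
      \<le> t + 2 * ruzsa_d + binary_entropy p"
    using ent_unif_diff_le[OF T(1) pos D t] gap by (simp add: r_def)
  \<comment> \<open>\<open>self_diff T\<close> contains a translate of \<open>T\<close>, so its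
    measure is positive and the logarithm of the quotient can be split.\<close>
  have "T \<noteq> {}" using pos by auto
  then obtain a where "a \<in> T" by blast
  have "measure \<mu> T = measure \<mu> ((\<lambda>x. - a + x) ` T)"
    using shift[OF T(1), of "- a"] by (simp add: measure_def)
  also have "\<dots> \<le> measure \<mu> (self_diff T)"
    using \<open>a \<in> T\<close> T(2) by (intro finite_measure_mono) (auto simp: self_diff_def)
  finally have "measure \<mu> (self_diff T) > 0" using pos by simp
  then have "ln (measure \<mu> (self_diff T) / measure \<mu> T) = ln (measure \<mu> (self_diff T)) - ln (measure \<mu> T)"
    using pos by (simp add: ln_div)
  also have "ln (measure \<mu> (self_diff T)) \<le> ln (exp (2 * t + ent g))"
    using self_diff_upper_bound[OF D t T(2)] \<open>measure \<mu> (self_diff T) > 0\<close> by (intro ln_mono) auto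
  finally show "ln (measure \<mu> (self_diff T) / measure \<mu> T) \<le> 2 * (t + 2 * ruzsa_d + binary_entropy p)"
    using gap by (simp add: r_def)
qed

text \<open>Markov's inequality is strict here, which leaves room for an inner approximation by a closed set.\<close>

lemma markov_strict:
  assumes "t > 0"
  shows "(\<integral>x. f x * indicator {x. D x > ennreal t} x \<partial>\<mu>) < 2 * ruzsa_d / t \<or> ruzsa_d = 0"
proof (rule ccontr)
  define e where "e = (\<integral>x. f x * indicator {x. D x > ennreal t} x \<partial>\<mu>)"
  assume "\<not> ?thesis"
  then have d: "ruzsa_d > 0" and e: "e \<ge> 2 * ruzsa_d / t"
    using ruzsa_d(3) by (auto simp: e_def)
  have A: "{x. D x > ennreal t} \<in> sets \<mu>"
    using measurable_sets[of D \<mu> borel "{ennreal t<..}"] by (auto simp: vimage_def)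
  note [measurable] = A
  have f0: "0 \<le> f x" for x by (rule prob_densD(1)[OF f(1)])
  have int: "integrable \<mu> (\<lambda>x. f x * indicator {x. D x > ennreal t} x)"
    using prob_densD(2)[OF f(1)] A by (intro integrable_real_mult_indicator) auto
  have eq: "(\<integral>\<^sup>+x. ennreal (f x * indicator {x. D x > ennreal t} x) \<partial>\<mu>) = ennreal e"
    unfolding e_def using int f0 by (intro nn_integral_eq_integral) auto
  \<comment> \<open>This is the excess that Markov's inequality throws away. If the inequality were
    not strict, the excess would integrate to 0, so \<open>f\<close> would vanish almost everywhere
    on the set, contrary to \<open>e > 0\<close>.\<close>
  let ?h = "\<lambda>x. ennreal (f x * indicator {x. D x > ennreal t} x) * (D x - ennreal t)"
  have "ennreal (e * t) + (\<integral>\<^sup>+x. ?h x \<partial>\<mu>) =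
      (\<integral>\<^sup>+x. ennreal (f x * indicator {x. D x > ennreal t} x) * ennreal t + ?h x \<partial>\<mu>)"
    using \<open>t > 0\<close> f0 by (subst nn_integral_add)
      (auto simp: nn_integral_multc eq e_def intro!: ennreal_mult Bochner_Integration.integral_nonneg)
  also have "\<dots> \<le> (\<integral>\<^sup>+x. ennreal (f x) * D x \<partial>\<mu>)"
  proof (intro nn_integral_mono)
    fix x
    show "ennreal (f x * indicator {x. D x > ennreal t} x) * ennreal t + ?h x \<le> ennreal (f x) * D x"
      by (auto simp: distrib_left[symmetric] add_diff_inverse_ennreal less_imp_le split: split_indicator)
  qed
  also have "\<dots> \<le> ennreal (2 * ruzsa_d)"
    unfolding nn_integral_f_D by (intro ennreal_leI ruzsa_d)
  also have "\<dots> \<le> ennreal (e * t)"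
    using e \<open>t > 0\<close> by (intro ennreal_leI) (simp add: field_simps)
  finally have "ennreal (e * t) + (\<integral>\<^sup>+x. ?h x \<partial>\<mu>) \<le> ennreal (e * t) + 0" by simp
  then have "(\<integral>\<^sup>+x. ?h x \<partial>\<mu>) \<le> 0"
    by (subst (asm) ennreal_add_left_cancel_le) auto
  then have "(\<integral>\<^sup>+x. ?h x \<partial>\<mu>) = 0" by simp
  then have "AE x in \<mu>. ?h x = 0" by (subst (asm) nn_integral_0_iff_AE) auto
  then have "AE x in \<mu>. f x * indicator {x. D x > ennreal t} x = 0"
    using f0 by (auto elim!: eventually_mono simp: diff_eq_0_iff_ennreal ennreal_eq_0_iff split: split_indicator)
      (metis order.antisym f0 leD)
  then have "e = (\<integral>x. 0 \<partial>\<mu>)"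
    unfolding e_def by (intro integral_cong_AE) auto
  moreover have "e > 0" using e d \<open>t > 0\<close> by (smt (verit) divide_pos_pos)
  ultimately show False by simp
qed

end

section \<open>Closed difference sets and closed cosets\<close>

lemma closed_image_diff:
  fixes A B :: "'a::topological_ab_group_add set"
  assumes "compact (UNIV :: 'a set)" and "metrizable_space (euclidean :: 'a topology)"
    and "closed A" "closed B"
  shows "closed ((\<lambda>(x, y). x - y) ` (A \<times> B))"
proof -
  have "compact A" "compact B"
    using compact_Int_closed[OF assms(1,3)] compact_Int_closed[OF assms(1,4)]
    by (simp_all only: Int_UNIV_left)
  then have "compact ((\<lambda>(x, y). x - y) ` (A \<times> B))"
    by (intro compact_continuous_image compact_Times)
      (auto simp: case_prod_beta' intro!: continuous_on_diff continuous_on_fst continuous_on_snd continuous_on_id)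
  then show ?thesis
    unfolding closed_closedin
    by (intro compactin_imp_closedin[OF metrizable_imp_Hausdorff_space[OF assms(2)]]) simp
qed

lemma self_diff_eq: "self_diff S = (\<lambda>(x, y). x - y) ` (S \<times> S)"
  by (auto simp: self_diff_def)

text \<open>The last hypothesis makes \<open>S\<close> a coset. If a closed subset \<open>T\<close> fills more than half of it,
  then \<open>T - T\<close> is the underlying subgroup.\<close>

lemma closed_coset:
  fixes \<mu> :: "'a::topological_ab_group_add measure"
  assumes top: "compact (UNIV :: 'a set)" "metrizable_space (euclidean :: 'a topology)"
    and "haar_group \<mu>" and sets_eq: "sets \<mu> = sets borel"
    and S: "S \<in> sets \<mu>" "measure \<mu> S > 0"
    and coset: "\<And>x y z. x \<in> S \<Longrightarrow> y \<in> S \<Longrightarrow> z \<in> S \<Longrightarrow> x - y + z \<in> S"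
  shows "closed S"
proof -
  interpret haar_group \<mu> by fact
  obtain T where T: "closed T" "T \<subseteq> S" "measure \<mu> T > measure \<mu> S - measure \<mu> S / 2"
    by (rule closed_inner_approx[OF top(2) finite_measure_axioms sets_eq, of S "measure \<mu> S / 2"])
      (use S in \<open>auto simp: sets_eq\<close>)
  have T_sets: "T \<in> sets \<mu>" using T(1) by (simp add: sets_eq)
  obtain s where s: "s \<in> S" using S(2) by (metis all_not_in_conv less_irrefl measure_empty)
  have "S = (\<lambda>(x, y). x - y) ` ({s} \<times> self_diff T)"
  proof (intro equalityI subsetI)
    fix x assume x: "x \<in> S"
    let ?T = "(\<lambda>y. (x - s) + y) ` T"
    have "?T \<subseteq> S" using coset[OF x s] T(2) by (auto simp: algebra_simps)
    have "emeasure \<mu> ?T = emeasure \<mu> T" by (rule shift[OF T_sets])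
    have "?T = (\<lambda>y. (s - x) + y) -` T"
    proof (intro equalityI subsetI)
      fix y assume "y \<in> (\<lambda>y. (s - x) + y) -` T"
      then show "y \<in> ?T" by (intro image_eqI[of _ _ "(s - x) + y"]) (auto simp: algebra_simps)
    qed (auto simp: algebra_simps)
    then have T'_sets: "?T \<in> sets \<mu>"
      using measurable_sets[of "\<lambda>y. (s - x) + y" \<mu> \<mu> T] T_sets by simp
    \<comment> \<open>Both sets lie in \<open>S\<close> and each carries more than half of its
      measure. A common point exhibits \<open>x - s\<close> as a difference of two elements of
      \<open>T\<close>.\<close>
    have "T \<inter> ?T \<noteq> {}"
    proof
      assume "T \<inter> ?T = {}"
      then have "measure \<mu> T + measure \<mu> ?T = measure \<mu> (T \<union> ?T)"
        using T_sets T'_sets by (simp add: finite_measure_Union)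
      also have "\<dots> \<le> measure \<mu> S"
        using T(2) \<open>?T \<subseteq> S\<close> S(1) by (intro finite_measure_mono) auto
      finally show False using T(3) \<open>emeasure \<mu> ?T = emeasure \<mu> T\<close> by (simp add: measure_def)
    qed
    then obtain t1 t2 where "t1 \<in> T" "t2 \<in> T" "t1 = x - s + t2" by auto
    then have "x = s - (t2 - t1)" "t2 - t1 \<in> self_diff T"
      unfolding self_diff_def by (simp, blast)
    then show "x \<in> (\<lambda>(x, y). x - y) ` ({s} \<times> self_diff T)"
      by force
  next
    fix x assume "x \<in> (\<lambda>(x, y). x - y) ` ({s} \<times> self_diff T)"
    then obtain t1 t2 where "t1 \<in> T" "t2 \<in> T" "x = s - (t1 - t2)" by (auto simp: self_diff_def)
    then have "x = s - t1 + t2" "t1 \<in> S" "t2 \<in> S" using T(2) by (auto simp: algebra_simps)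
    then show "x \<in> S" using coset[OF s] by simp
  qed
  moreover have "closed {s}"
    unfolding closed_closedin closedin_Hausdorff_sing_eq[OF metrizable_imp_Hausdorff_space[OF top(2)]] by simp
  ultimately show ?thesis
    using closed_image_diff[OF top _ closed_image_diff[OF top T(1) T(1)]]
    by (simp add: self_diff_eq)
qed

section \<open>Choice of the constant and of the set\<close>

definition bound :: "real \<Rightarrow> real \<Rightarrow> real" where
  "bound d C = (C + 2) * d + binary_entropy (1 - 2 / C)"

text \<open>Past a certain point the linear term alone exceeds the value at \<open>C = 4\<close>, so
  a minimum over a compact interval is global. The two claimed inequalities have right sides
  \<open>bound d C\<close> and \<open>2 * bound d C\<close>, hence one minimiser serves
  both.\<close>

lemma bound_minimum:
  assumes "d > 0"
  obtains C where "C \<ge> 4" "\<And>C'. C' \<ge> 4 \<Longrightarrow> bound d C \<le> bound d C'"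
proof -
  \<comment> \<open>Chosen so that \<open>(B + 2) * d\<close> equals
    \<open>bound d 4\<close>.\<close>
  define B where "B = 4 + binary_entropy (1 / 2) / d"
  have "binary_entropy (1 / 2) \<ge> 0" by (rule binary_entropy_nonneg) auto
  then have B: "B \<ge> 4" using assms by (simp add: B_def)
  have "continuous_on {4..B} (bound d)"
    unfolding bound_def binary_entropy_def by (intro continuous_intros) auto
  then obtain C where C: "C \<in> {4..B}" "\<And>C'. C' \<in> {4..B} \<Longrightarrow> bound d C \<le> bound d C'"
    using continuous_attains_inf[of "{4..B}" "bound d"] B by auto
  have "bound d C \<le> bound d C'" if "C' \<ge> 4" for C'
  proof (cases "C' \<le> B")
    case False
    have "bound d C \<le> bound d 4" using C(2)[of 4] B by simp
    also have "\<dots> = (B + 2) * d"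
      using assms by (simp add: bound_def B_def field_simps)
    also have "\<dots> \<le> bound d C'"
      using False assms that binary_entropy_nonneg[of "1 - 2 / C'"]
      by (simp add: bound_def add_increasing2)
    finally show ?thesis .
  qed (use C that in auto)
  then show ?thesis using C(1) that[of C] by auto
qed

lemma (in two_densities) D_level_set: "{x. D x \<le> c} \<in> sets \<mu>"
  using measurable_sets[of D \<mu> borel "{..c}"] by (auto simp: vimage_def)

lemma exists_good_set:
  fixes \<mu> :: "'a::topological_ab_group_add measure"
  assumes top: "compact (UNIV :: 'a set)" "metrizable_space (euclidean :: 'a topology)"
    and "two_densities \<mu> f g" and sets_eq: "sets \<mu> = sets borel"
  defines "d \<equiv> two_densities.ruzsa_d \<mu> f g"
  obtains S where "closed S" "measure \<mu> S > 0"
    "\<And>C. C \<ge> 4 \<Longrightarrow> haar_group.ent \<mu> (haar_group.diff_dens \<mu> (unif_dens \<mu> S) g) - ln (measure \<mu> S) / 2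
       - haar_group.ent \<mu> g / 2 \<le> bound d C"
    "\<And>C. C \<ge> 4 \<Longrightarrow> ln (measure \<mu> (self_diff S) / measure \<mu> S) \<le> 2 * bound d C"
proof -
  interpret two_densities \<mu> f g by fact
  define \<nu> where "\<nu> = density \<mu> f"
  interpret \<nu>: prob_space \<nu> unfolding \<nu>_def by (rule prob_densD[OF f(1)])
  have f0: "0 \<le> f x" for x by (rule prob_densD(1)[OF f(1)])
  have int: "integrable \<mu> (\<lambda>x. f x * indicator A x)" if "A \<in> sets \<mu>" for A
    using prob_densD(2)[OF f(1)] that by (intro integrable_real_mult_indicator) auto
  have \<nu>: "(\<integral>x. f x * indicator A x \<partial>\<mu>) = measure \<nu> A" if A: "A \<in> sets \<mu>" for A
  proof -
    have "ennreal (measure \<nu> A) = emeasure \<nu> A"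
      by (simp add: \<nu>.emeasure_eq_measure)
    also have "\<dots> = (\<integral>\<^sup>+x. ennreal (f x) * indicator A x \<partial>\<mu>)"
      using A unfolding \<nu>_def by (intro emeasure_density) auto
    also have "\<dots> = (\<integral>\<^sup>+x. ennreal (f x * indicator A x) \<partial>\<mu>)"
      by (intro nn_integral_cong) (simp split: split_indicator)
    also have "\<dots> = ennreal (\<integral>x. f x * indicator A x \<partial>\<mu>)"
      using int[OF A] f0 by (intro nn_integral_eq_integral) auto
    finally show ?thesis
      using f0 by (subst (asm) ennreal_inj) (auto intro!: Bochner_Integration.integral_nonneg)
  qed
  have space_\<nu>: "space \<nu> = UNIV" and sets_\<nu>: "sets \<nu> = sets \<mu>" by (simp_all add: \<nu>_def)
  note result = that
  have main: thesis if S: "closed S" and D: "\<And>x. x \<in> S \<Longrightarrow> D x \<le> ennreal t" and t: "t \<ge> 0"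
    and p: "measure \<nu> S \<ge> 1 / 2"
    and le: "\<And>C. C \<ge> 4 \<Longrightarrow> t + 2 * d + binary_entropy (measure \<nu> S) \<le> bound d C" for S t
  proof -
    have S_sets: "S \<in> sets \<mu>" using S by (simp add: sets_eq)
    \<comment> \<open>Closedness of \<open>S\<close> is essential here: its difference set is then
      closed, whereas that of a Borel set need not be Borel.\<close>
    have SS: "self_diff S \<in> sets \<mu>"
      using closed_image_diff[OF top S S] by (simp add: sets_eq self_diff_eq)
    note b = level_subset_bounds[OF S_sets SS D t \<nu>[OF S_sets, symmetric] p, folded d_def]
    show thesis
      using S b le by (intro result[of S]) (fastforce intro: order_trans)+
  qed
  show thesis
  proof (cases "d = 0")
    case True
    \<comment> \<open>For \<open>d = 0\<close> the bound tends to 0 as \<open>C\<close> grows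
      without attaining it, so no mass may be lost to a closed approximation. The zero set of
      \<open>D\<close> has full mass under the law of \<open>X\<close>, and
      \<open>binary_entropy 1 = 0\<close>; it is closed because it is a coset.\<close>
    define S where "S = {x. D x \<le> ennreal 0}"
    have S_sets: "S \<in> sets \<mu>" unfolding S_def by (rule D_level_set)
    have "ent k - ent g = 0" using True ruzsa_d(1) ent_ge_g by (simp add: d_def)
    then have "(\<integral>\<^sup>+x. ennreal (f x) * D x \<partial>\<mu>) = 0" using nn_integral_f_D by simp
    then have "AE x in \<mu>. ennreal (f x) * D x = 0" by (subst (asm) nn_integral_0_iff_AE) auto
    then have "AE x in \<mu>. f x * indicator S x = f x"
      by eventually_elim (use f0 in \<open>auto simp: S_def ennreal_eq_0_iff order.antisym\<close>)
    then have "(\<integral>x. f x * indicator S x \<partial>\<mu>) = (\<integral>x. f x \<partial>\<mu>)"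
      using S_sets by (intro integral_cong_AE) auto
    then have p1: "measure \<nu> S = 1" by (simp add: \<nu>[OF S_sets] prob_densD(4)[OF f(1)])
    have "measure \<mu> S > 0"
      using measure_lower_bound(2)[OF S_sets refl] p1 by (simp add: \<nu>[OF S_sets])
    then have "closed S"
      using D_eq_0_coset by (intro closed_coset[OF top haar_group_axioms sets_eq S_sets]) (auto simp: S_def)
    then show thesis
    proof (rule main)
      fix C :: real assume "C \<ge> 4"
      then show "0 + 2 * d + binary_entropy (measure \<nu> S) \<le> bound d C"
        using True p1 binary_entropy_nonneg[of "1 - 2 / C"] by (simp add: bound_def binary_entropy_def[of 1])
    qed (auto simp: p1, auto simp: S_def)
  next
    case False
    then have d: "d > 0" using ruzsa_d(3) by (simp add: d_def)
    obtain C where C: "C \<ge> 4" "\<And>C'. C' \<ge> 4 \<Longrightarrow> bound d C \<le> bound d C'"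
      using bound_minimum[OF d] by metis
    \<comment> \<open>At this level Markov's inequality loses mass less than
      \<open>2 * d / (C * d) = 2 / C\<close>, and the strictness leaves a margin for a closed subset
      \<open>T\<close>.\<close>
    define S where "S = {x. D x \<le> ennreal (C * d)}"
    have S_sets: "S \<in> sets \<mu>" unfolding S_def by (rule D_level_set)
    have "- S = {x. D x > ennreal (C * d)}" by (auto simp: S_def)
    moreover have "- S \<in> sets \<mu>" using sets.compl_sets[OF S_sets] by (simp add: Compl_eq_Diff_UNIV)
    ultimately have "measure \<nu> (- S) < 2 * d / (C * d)"
      using markov_strict[of "C * d"] C(1) d by (simp add: \<nu>[symmetric] d_def)
    then have S_gt: "measure \<nu> S > 1 - 2 / C"
      using \<nu>.prob_compl[of S] S_sets d by (simp add: sets_\<nu> space_\<nu> Compl_eq_Diff_UNIV)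
    obtain T where T: "closed T" "T \<subseteq> S" "measure \<nu> T > 1 - 2 / C"
      by (rule closed_inner_approx[OF top(2) \<nu>.finite_measure_axioms, of S "measure \<nu> S - (1 - 2 / C)"])
        (use S_sets S_gt in \<open>auto simp: sets_\<nu> sets_eq\<close>)
    have C': "1 - 2 / C \<ge> 1 / 2" "1 - 2 / C < 1" using C(1) by (auto simp: field_simps)
    show thesis
    proof (rule main[OF T(1)])
      show "D x \<le> ennreal (C * d)" if "x \<in> T" for x using that T(2) by (auto simp: S_def)
      show "0 \<le> C * d" using C(1) d by simp
      show "1 / 2 \<le> measure \<nu> T" using C'(1) T(3) by linarith
      fix C2 :: real assume "C2 \<ge> 4"
      \<comment> \<open>From \<open>C \<ge> 4\<close> both arguments are at least
        \<open>1 / 2\<close>, where binary entropy decreases.\<close>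
      have "binary_entropy (measure \<nu> T) \<le> binary_entropy (1 - 2 / C)"
        using C' T(3) by (intro binary_entropy_antimono) auto
      then have "C * d + 2 * d + binary_entropy (measure \<nu> T) \<le> bound d C"
        by (simp add: bound_def algebra_simps)
      also have "\<dots> \<le> bound d C2" by (rule C(2)[OF \<open>C2 \<ge> 4\<close>])
      finally show "C * d + 2 * d + binary_entropy (measure \<nu> T) \<le> bound d C2" .
    qed
  qed
qed

section \<open>Return to random variables\<close>

lemma haar_group_haar_prob:
  fixes \<mu> :: "'a::topological_ab_group_add measure"
  assumes "compact (UNIV :: 'a set)" "metrizable_space (euclidean :: 'a topology)" and "haar_prob \<mu>"
  shows "haar_group \<mu>"
proof -
  have sets: "sets \<mu> = sets borel" and "prob_space \<mu>"
    and "\<And>A g. A \<in> sets \<mu> \<Longrightarrow> emeasure \<mu> ((\<lambda>x. g + x) ` A) = emeasure \<mu> A"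
    using assms(3) by (auto simp: haar_prob_def)
  moreover have "space \<mu> = UNIV" using sets_eq_imp_space_eq[OF sets] by simp
  moreover have "(\<lambda>(x, y). x - y) \<in> \<mu> \<Otimes>\<^sub>M \<mu> \<rightarrow>\<^sub>M \<mu>"
    using measurable_diff_compact_metrizable[OF assms(1,2)]
    by (simp add: sets cong: measurable_cong_sets sets_pair_measure_cong)
  ultimately show ?thesis
    by (simp add: haar_group_def haar_group_axioms_def)
qed

theorem proposition2p9:
  fixes \<mu> :: "'a::topological_ab_group_add measure"
    and M :: "'b measure" and X :: "'b \<Rightarrow> 'a"
    and N :: "'c measure" and Y :: "'c \<Rightarrow> 'a"
  assumes "compact (UNIV :: 'a set)"
    and "metrizable_space (euclidean :: 'a topology)"
    and "haar_prob \<mu>"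
    and "prob_space M" and "X \<in> borel_measurable M"
    and "prob_space N" and "Y \<in> borel_measurable N"
    and "rv_entropy \<mu> M X > - \<infinity>" and "rv_entropy \<mu> N Y > - \<infinity>"
  shows "\<exists>S. S \<noteq> {} \<and> closed S \<and> measure \<mu> S > 0 \<and>
           (\<forall>C::real. C \<ge> 4 \<longrightarrow>
             (\<forall>(L :: 'd measure) U. prob_space L \<and> uniformly_distributed \<mu> S L U \<longrightarrow>
               ruzsa_dist \<mu> L U N Y
                 \<le> ereal (C + 2) * ruzsa_dist \<mu> M X N Y + ereal (binary_entropy (1 - 2 / C))) \<and>
             ereal (ln (measure \<mu> (self_diff S) / measure \<mu> S))
               \<le> ereal (2 * C + 4) * ruzsa_dist \<mu> M X N Y + ereal (2 * binary_entropy (1 - 2 / C)))"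
proof -
  interpret haar_group \<mu> by (rule haar_group_haar_prob[OF assms(1-3)])
  have sets_eq: "sets \<mu> = sets borel" using assms(3) by (simp add: haar_prob_def)
  have X: "X \<in> M \<rightarrow>\<^sub>M \<mu>" and Y: "Y \<in> N \<rightarrow>\<^sub>M \<mu>"
    using assms(5,7) by (simp_all add: sets_eq cong: measurable_cong_sets)
  obtain f where Xf: "prob_dens f" "finite_ent f" "distr M \<mu> X = density \<mu> f"
    by (rule finite_rv_entropyE[OF assms(4) X assms(8)])
  obtain g where Yg: "prob_dens g" "finite_ent g" "distr N \<mu> Y = density \<mu> g"
    by (rule finite_rv_entropyE[OF assms(6) Y assms(9)])
  interpret two_densities \<mu> f g by unfold_locales (use Xf Yg in auto)
  have XY: "ruzsa_dist \<mu> M X N Y = ereal ruzsa_d"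
    using ruzsa_dist_density[OF assms(4,6) X Xf Y Yg] by (simp add: ruzsa_d_def)
  obtain S where S: "closed S" "measure \<mu> S > 0"
    "\<And>C. C \<ge> 4 \<Longrightarrow> ent (diff_dens (unif_dens \<mu> S) g) - ln (measure \<mu> S) / 2 - ent g / 2 \<le> bound ruzsa_d C"
    "\<And>C. C \<ge> 4 \<Longrightarrow> ln (measure \<mu> (self_diff S) / measure \<mu> S) \<le> 2 * bound ruzsa_d C"
    using exists_good_set[OF assms(1,2) two_densities_axioms sets_eq] by blast
  have S_sets: "S \<in> sets \<mu>" using S(1) by (simp add: sets_eq)
  note unif = unif_dens[OF S_sets S(2)]
  have 1: "ruzsa_dist \<mu> L U N Y \<le> ereal (C + 2) * ruzsa_dist \<mu> M X N Y + ereal (binary_entropy (1 - 2 / C))"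
    if "C \<ge> 4" "prob_space L" "uniformly_distributed \<mu> S L U" for C and L :: "'d measure" and U
  proof -
    have dens: "ennreal (unif_dens \<mu> S x) = indicator S x / emeasure \<mu> S" for x
      using S(2) by (auto simp: unif_dens_def emeasure_eq_measure divide_ennreal[symmetric] ennreal_1[symmetric]
          simp del: ennreal_1 split: split_indicator)
    have U: "U \<in> L \<rightarrow>\<^sub>M \<mu>" "distr L \<mu> U = density \<mu> (unif_dens \<mu> S)"
      using that(3) by (auto simp: uniformly_distributed_def distributed_def dens)
    have "ruzsa_dist \<mu> L U N Y \<le> ereal (bound ruzsa_d C)"
      using S(3)[OF that(1)] unif(3)
      by (simp add: ruzsa_dist_density[OF that(2) assms(6) U(1) unif(1,2) U(2) Y Yg])
    then show ?thesis by (simp add: XY bound_def)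
  qed
  have 2: "ereal (ln (measure \<mu> (self_diff S) / measure \<mu> S))
      \<le> ereal (2 * C + 4) * ruzsa_dist \<mu> M X N Y + ereal (2 * binary_entropy (1 - 2 / C))" if "C \<ge> 4" for C
    using S(4)[OF that] by (simp add: XY bound_def algebra_simps)
  have "S \<noteq> {}" using S(2) by auto
  then show ?thesis
    by (intro exI[of _ S] conjI allI impI) (use S(1,2) 1 2 in \<open>simp_all only: not_False_eq_True\<close>)
qed

end
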